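(* Let $I$ be a countable set and let $(\mathbb{X}_i,\mathcal{X}_i,\mu_i)_{i\in I}$ be probability spaces. For each $i\in I$ let $\mathcal{A}_i$ be a linear subspace of $L^2(\mathbb{X}_i,\mu_i)$ which contains the constant functions. Suppose that for every $i\in I$, $\mu_i$ satisfies a logarithmic Sobolev inequality of the form $$\forall f\in\mathcal{A}_i,\quad \mathrm{Ent}_{\mu_i}(f^2)\le\mathbb{E}_{\mu_i}\left(R_i(f)^2\right),$$ where $R_i$ is a linear operator from $\mathcal{A}_i$ to $L^2(\mu_i)$ with value zero on any constant function. Furthermore, suppose that for every $i\in I$ and every $f\in\mathcal{A}^I$, $$\int f\,d\otimes_{j\neq i}\mu_j\in\mathcal{A}_i\quad\text{and}\quad R_i\left(\int f\,d\otimes_{j\neq i}\mu_j\right)=\int R_i(f)\,d\otimes_{j\neq i}\mu_j.$$ Then $\mu^I=\otimes_{i\in I}\mu_i$ satisfies $$\forall f\in\mathcal{A}^{I},\quad \mathrm{Var}_{\mu^I}(f)\log\frac{\mathrm{Var}_{\mu^I}(f)}{\sum_{i\in I}\|\Delta_i f\|_{1,\mu^I}^2}\le\sum_{i\in I}\mathbb{E}_{\mu^I}\left(R_i(f)^2\right),$$ where $\Delta_i$ is the operator on $L^2(\mu^I)$ given by $\Delta_i f=f-\int f\,d\mu_i$.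
   Context: Entropy of a positive function $f$: $\mathrm{Ent}_\mu(f)=\int f\log f\,d\mu-\int f\,d\mu\,\log\int f\,d\mu$. $\|f\|_{1,\mu}=\int|f|\,d\mu$. The left-hand side is read as $0$ when $\mathrm{Var}_{\mu^I}(f)=0$. In $\int f\,d\mu_i$ only the coordinate $x_i$ is integrated. For $x^{-j}\in\prod_{i\neq j}\mathbb{X}_i$ and a function $f$ on $\prod_{i\in I}\mathbb{X}_i$, $f_{x^{-j}}$ is the function $x_j\mapsto f(x)$ on $\mathbb{X}_j$ obtained by keeping $x^{-j}$ fixed. Define $$\mathcal{A}^I=\{f\in L^2(\textstyle\prod_{i}\mathbb{X}_i,\otimes_i\mu_i): \forall j\in I,\ f_{x^{-j}}\in\mathcal{A}_j\text{ for }\otimes_{i\ne j}\mu_i\text{-a.e. }x^{-j}\}.$$ $R_j$ is extended to $\mathcal{A}^I$ by acting on coordinate $j$ only: $R_j(f)(x)=R_j(f_{x^{-j}})(x_j)$. *)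

theory Defs
  imports "HOL-Probability.Probability"
begin

text \<open>
  The space L2 is represented by square-integrable functions rather than by classes modulo
  almost-everywhere equality. A subspace of L2 is therefore also required to be saturated for
  a.e. equality, and a linear operator has to respect a.e. equality, with all of its equations
  holding a.e.
\<close>

definition L2 :: "'a measure \<Rightarrow> ('a \<Rightarrow> real) set" where
  "L2 M = {f \<in> borel_measurable M. integrable M (\<lambda>x. (f x)\<^sup>2)}"

definition L2_subspace :: "'a measure \<Rightarrow> ('a \<Rightarrow> real) set \<Rightarrow> bool" where
  "L2_subspace M A \<longleftrightarrow>
     A \<subseteq> L2 M \<and>
     (\<lambda>x. 0) \<in> A \<and>
     (\<forall>f\<in>A. \<forall>g\<in>A. (\<lambda>x. f x + g x) \<in> A) \<and>
     (\<forall>c. \<forall>f\<in>A. (\<lambda>x. c * f x) \<in> A) \<and>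
     (\<forall>f\<in>A. \<forall>g\<in>L2 M. (AE x in M. f x = g x) \<longrightarrow> g \<in> A)"

definition L2_linear_operator ::
    "'a measure \<Rightarrow> ('a \<Rightarrow> real) set \<Rightarrow> (('a \<Rightarrow> real) \<Rightarrow> 'a \<Rightarrow> real) \<Rightarrow> bool" where
  "L2_linear_operator M A R \<longleftrightarrow>
     (\<forall>f\<in>A. R f \<in> L2 M) \<and>
     (\<forall>f\<in>A. \<forall>g\<in>A. (AE x in M. f x = g x) \<longrightarrow> (AE x in M. R f x = R g x)) \<and>
     (\<forall>f\<in>A. \<forall>g\<in>A. AE x in M. R (\<lambda>x. f x + g x) x = R f x + R g x) \<and>
     (\<forall>c. \<forall>f\<in>A. AE x in M. R (\<lambda>x. c * f x) x = c * R f x)"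

text \<open>
  On a probability space the function f ln f is bounded below by -1/e, so for integrable
  f \<ge> 0 the only way it can fail to be integrable is that its integral is plus infinity.
  Note ln 0 = 0, which gives 0 ln 0 = 0.
\<close>

definition Ent :: "'a measure \<Rightarrow> ('a \<Rightarrow> real) \<Rightarrow> ereal" where
  "Ent M f =
     (if integrable M (\<lambda>x. f x * ln (f x))
      then ereal ((\<integral>x. f x * ln (f x) \<partial>M) - (\<integral>x. f x \<partial>M) * ln (\<integral>x. f x \<partial>M))
      else \<infinity>)"

definition norm1 :: "'a measure \<Rightarrow> ('a \<Rightarrow> real) \<Rightarrow> real" where
  "norm1 M f = (\<integral>x. \<bar>f x\<bar> \<partial>M)"

definition ln_extended :: "ennreal \<Rightarrow> ereal" where
  "ln_extended x =
     (if x = 0 then -\<infinity> else if x = \<infinity> then \<infinity> else ereal (ln (enn2real x)))"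

text \<open>
  A point of the product over \<open>I\<close> is a function on \<open>I\<close>. For \<open>y\<close> in the product over
  \<open>I - {j}\<close>, the point with coordinate \<open>t\<close> at \<open>j\<close> and coordinates \<open>y\<close> elsewhere is \<open>y(j := t)\<close>.
\<close>

definition slice :: "'i \<Rightarrow> (('i \<Rightarrow> 'a) \<Rightarrow> real) \<Rightarrow> ('i \<Rightarrow> 'a) \<Rightarrow> 'a \<Rightarrow> real" where
  "slice j f y = (\<lambda>t. f (y(j := t)))"

definition product_class ::
    "'i set \<Rightarrow> ('i \<Rightarrow> 'a measure) \<Rightarrow> ('i \<Rightarrow> ('a \<Rightarrow> real) set) \<Rightarrow> (('i \<Rightarrow> 'a) \<Rightarrow> real) set" where
  "product_class I M A =
     {f \<in> L2 (PiM I M). \<forall>j\<in>I. AE y in PiM (I - {j}) M. slice j f y \<in> A j}"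

text \<open>
  \<open>T\<close> is the extension to the product class of the operator \<open>R\<close> on coordinate \<open>j\<close>. Since each
  \<open>R (slice j f y)\<close> is only determined up to a null set depending on \<open>y\<close>, the defining equation
  is an a.e. one, and \<open>T f\<close> is a jointly measurable version; it is unique up to a null
  set of the product.
\<close>

definition coordinate_extension ::
    "'i set \<Rightarrow> ('i \<Rightarrow> 'a measure) \<Rightarrow> ('i \<Rightarrow> ('a \<Rightarrow> real) set) \<Rightarrow> 'i \<Rightarrow>
     (('a \<Rightarrow> real) \<Rightarrow> 'a \<Rightarrow> real) \<Rightarrow>
     ((('i \<Rightarrow> 'a) \<Rightarrow> real) \<Rightarrow> ('i \<Rightarrow> 'a) \<Rightarrow> real) \<Rightarrow> bool" where
  "coordinate_extension I M A j R T \<longleftrightarrow>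
     (\<forall>f\<in>product_class I M A.
        T f \<in> borel_measurable (PiM I M) \<and>
        (AE y in PiM (I - {j}) M. AE t in M j. T f (y(j := t)) = R (slice j f y) t))"

definition integrate_others ::
    "'i set \<Rightarrow> ('i \<Rightarrow> 'a measure) \<Rightarrow> 'i \<Rightarrow> (('i \<Rightarrow> 'a) \<Rightarrow> real) \<Rightarrow> 'a \<Rightarrow> real" where
  "integrate_others I M i f = (\<lambda>t. \<integral>y. f (y(i := t)) \<partial>PiM (I - {i}) M)"

definition Delta ::
    "('i \<Rightarrow> 'a measure) \<Rightarrow> 'i \<Rightarrow> (('i \<Rightarrow> 'a) \<Rightarrow> real) \<Rightarrow> ('i \<Rightarrow> 'a) \<Rightarrow> real" where
  "Delta M i f = (\<lambda>x. f x - (\<integral>t. f (x(i := t)) \<partial>M i))"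

end

theory Submission
  imports Defs
begin

text \<open>
  Let \<open>P\<close> be the product measure and let \<open>E\<^sub>J f\<close> be the conditional expectation of \<open>f\<close> given the
  coordinates in \<open>J\<close>. Revealing the coordinates of a finite set one at a time splits the conditional
  expectation of \<open>f\<close> into orthogonal martingale increments \<open>d = E\<^sub>K f - E\<^sub>J f\<close> with
  \<open>K = J \<union> {j}\<close>, and its variance is the sum of the \<open>\<integral> d\<^sup>2\<close>. The logarithmic Sobolev inequality is
  applied to each increment separately, not to \<open>f\<close>.

  Entropy is subadditive over coordinates, so the entropy of \<open>d\<^sup>2\<close> is at most the sum over \<open>k \<in> K\<close> of
  the mean entropies in coordinate \<open>k\<close>, hence at most \<open>\<Sum>k\<in>K. \<integral> (R\<^sub>k d)\<^sup>2\<close>. As \<open>R\<^sub>k\<close> commutes with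
  averaging, \<open>R\<^sub>k d = E\<^sub>K (R\<^sub>k f) - E\<^sub>J (R\<^sub>k f)\<close> for \<open>k \<in> J\<close>, while \<open>R\<^sub>j d = E\<^sub>K (R\<^sub>j f)\<close> because \<open>R\<^sub>j\<close>
  kills functions that are constant in coordinate \<open>j\<close>. By orthogonality the square norms of these
  functions telescope over the increments to at most \<open>\<integral> (R\<^sub>k f)\<^sup>2\<close>, so no factor is lost in the sum.

  In the other direction, the entropy of \<open>d\<^sup>2\<close> is at least \<open>D ln (D / (\<integral> \<bar>d\<bar>)\<^sup>2)\<close> with \<open>D = \<integral> d\<^sup>2\<close>, by
  Jensen's inequality; and \<open>\<integral> \<bar>d\<bar> \<le> \<integral> \<bar>\<Delta>\<^sub>j f\<bar>\<close>, because \<open>d = E\<^sub>K (\<Delta>\<^sub>j f)\<close>. The log-sum inequality adds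
  these lower bounds up to \<open>V ln (V / S)\<close>, where \<open>V\<close> is the variance of \<open>E\<^sub>J f\<close> for the finite set \<open>J\<close>
  revealed so far and \<open>S\<close> is the sum of \<open>(\<integral> \<bar>\<Delta>\<^sub>j f\<bar>)\<^sup>2\<close> over \<open>j \<in> J\<close>. The theorem follows in the limit
  because \<open>\<integral> (E\<^sub>J f)\<^sup>2\<close> comes arbitrarily close to \<open>\<integral> f\<^sup>2\<close>.

  Two points need an argument of their own. First, nothing ensures that \<open>d\<^sup>2 ln d\<^sup>2\<close> is integrable over
  the product, so the entropies are compared for \<open>d\<^sup>2\<close> truncated to an interval \<open>[a, b]\<close> with \<open>a > 0\<close>.
  A truncated function may leave the domain of \<open>R\<^sub>k\<close>, but truncation only decreases the entropy in each coordinate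
  (\<open>clamp_entropy_le\<close>), and removing it in the end involves only the first two moments of \<open>d\<close>.
  Secondly, the commutation hypothesis concerns the integral over all coordinates but one. For \<open>E\<^sub>J\<close>
  it is applied to the function obtained from \<open>f\<close> by freezing the coordinates in \<open>J - {k}\<close>, which
  is again in the product class (\<open>operator_avg\<close>).
\<close>

section \<open>Square-integrable functions and measure-preserving maps\<close>

lemma integral_distr_eq:
  fixes f :: "'b \<Rightarrow> real"
  assumes "distr N L T = L" "T \<in> measurable N L" "f \<in> borel_measurable L"
  shows "(\<integral>z. f (T z) \<partial>N) = (\<integral>x. f x \<partial>L)"
    and "integrable N (\<lambda>z. f (T z)) \<longleftrightarrow> integrable L f"
  using integral_distr[of T N L f] integrable_distr_eq[of T N L f] assms by auto

lemma AE_distr_eq: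
  assumes "distr N L T = L" "T \<in> measurable N L" "AE x in L. Q x"
  shows "AE z in N. Q (T z)"
proof (rule AE_distrD[OF assms(2)])
  show "AE x in distr N L T. Q x" using assms(3) by (simp only: assms(1))
qed

lemma square_add_le: "(x + y)\<^sup>2 \<le> 2 * x\<^sup>2 + 2 * (y::real)\<^sup>2"
  using sum_squares_bound[of x y] by (simp add: power2_sum)

lemma L2_mult: 
  assumes "f \<in> L2 N" "g \<in> L2 N" shows "integrable N (\<lambda>x. f x * g x)"
proof (rule Bochner_Integration.integrable_bound)
  show "integrable N (\<lambda>x. (f x)\<^sup>2 + (g x)\<^sup>2)" using assms by (auto simp: L2_def)
  show "(\<lambda>x. f x * g x) \<in> borel_measurable N" using assms by (auto simp: L2_def)
  have "\<bar>a * b\<bar> \<le> \<bar>a\<^sup>2 + b\<^sup>2\<bar>" for a b :: real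
  proof -
    have "0 \<le> (\<bar>a\<bar> - \<bar>b\<bar>)\<^sup>2" by simp
    then have "2 * (\<bar>a\<bar> * \<bar>b\<bar>) \<le> a\<^sup>2 + b\<^sup>2" by (simp add: power2_diff)
    then show ?thesis by (simp add: abs_mult) (smt (verit) abs_ge_zero mult_nonneg_nonneg)
  qed
  then show "AE x in N. norm (f x * g x) \<le> norm ((f x)\<^sup>2 + (g x)\<^sup>2)" by simp
qed

lemma L2_add: "f \<in> L2 N \<Longrightarrow> g \<in> L2 N \<Longrightarrow> (\<lambda>x. f x + g x) \<in> L2 N"
  using L2_mult[of f N g] by (auto simp: L2_def power2_sum mult.assoc)

lemma L2_cmult: "f \<in> L2 N \<Longrightarrow> (\<lambda>x. c * f x) \<in> L2 N"
  by (auto simp: L2_def power_mult_distrib)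

lemma L2_diff: "f \<in> L2 N \<Longrightarrow> g \<in> L2 N \<Longrightarrow> (\<lambda>x. f x - g x) \<in> L2 N"
  using L2_add[OF _ L2_cmult[of g N "-1"], of f] by simp

lemma L2_dist_integrable: "f \<in> L2 N \<Longrightarrow> u \<in> L2 N \<Longrightarrow> integrable N (\<lambda>x. (f x - u x)\<^sup>2)"
  using L2_diff[of f N u] by (simp add: L2_def)

lemma L2_dominated:
  assumes "f \<in> L2 N" "g \<in> borel_measurable N" "\<And>x. x \<in> space N \<Longrightarrow> \<bar>g x\<bar> \<le> \<bar>f x\<bar>"
  shows "g \<in> L2 N"
proof -
  have "integrable N (\<lambda>x. (f x)\<^sup>2)" using assms by (simp add: L2_def)
  then have "integrable N (\<lambda>x. (g x)\<^sup>2)"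
  proof (rule Bochner_Integration.integrable_bound)
    show "AE x in N. norm ((g x)\<^sup>2) \<le> norm ((f x)\<^sup>2)"
      using assms(3) by (auto simp: abs_le_square_iff)
  qed (use assms(2) in measurable)
  then show ?thesis using assms(2) by (simp add: L2_def)
qed

lemma integral_square_cong_AE:
  fixes r w :: "'b \<Rightarrow> real"
  assumes "r \<in> borel_measurable N" "w \<in> borel_measurable N" "AE t in N. r t = w t"
  shows "(\<integral>t. (r t)\<^sup>2 \<partial>N) = (\<integral>t. (w t)\<^sup>2 \<partial>N)"
  using assms by (intro integral_cong_AE) auto

lemma sum_le_infsum_ennreal:
  fixes f :: "'b \<Rightarrow> ennreal"
  assumes "finite F" "F \<subseteq> A"
  shows "sum f F \<le> infsum f A"
  using assms by (subst nonneg_infsum_complete) (auto intro!: SUP_upper)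

section \<open>Resampling the coordinates of a product\<close>

text \<open>
  If \<open>x\<close> and \<open>y\<close> are independent points of the product, then so distributed is \<open>mix J x y\<close>
  (\<open>distr_mix\<close> below). Integrating over \<open>y\<close> alone is then conditioning on the coordinates in \<open>J\<close>,
  without a decomposition of the product into the coordinates in \<open>J\<close> and the others.
\<close>

definition mix :: "'i set \<Rightarrow> ('i \<Rightarrow> 'a) \<Rightarrow> ('i \<Rightarrow> 'a) \<Rightarrow> 'i \<Rightarrow> 'a" where
  "mix J x y = (\<lambda>i. if i \<in> J then x i else y i)"

lemma mix_mix_left: "mix J (mix K x y) z = mix (J \<inter> K) x (mix J y z)"
  by (auto simp: mix_def)

lemma mix_upd_inside: "k \<in> J \<Longrightarrow> mix (J - {k}) x (z(k := t)) = mix J (x(k := t)) z"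
  by (auto simp: mix_def fun_eq_iff)

lemma mix_upd_outside: "j \<notin> K \<Longrightarrow> mix K x (z(j := t)) = (mix K x z)(j := t)"
  by (auto simp: mix_def fun_eq_iff)

lemma mix_upd_absorb: "j \<in> K \<Longrightarrow> mix K x (z(j := t)) = mix K x z"
  by (auto simp: mix_def fun_eq_iff)

context product_prob_space
begin

abbreviation "P \<equiv> PiM I M"

sublocale PP: pair_prob_space P P
  by unfold_locales

lemma measurable_mix [measurable]:
  assumes [measurable]: "g \<in> measurable N P" "h \<in> measurable N P"
  shows "(\<lambda>p. mix J (g p) (h p)) \<in> measurable N P"
proof (rule measurable_PiM_single')
  fix i assume [measurable]: "i \<in> I"
  show "(\<lambda>p. mix J (g p) (h p) i) \<in> measurable N (M i)"
    unfolding mix_def by (cases "i \<in> J") simp_all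
next
  show "(\<lambda>p i. mix J (g p) (h p) i) \<in> space N \<rightarrow> (\<Pi>\<^sub>E i\<in>I. space (M i))"
    using measurable_space[OF assms(1)] measurable_space[OF assms(2)]
    by (fastforce simp: mix_def space_PiM PiE_iff extensional_def)
qed

lemma mix_space: "x \<in> space P \<Longrightarrow> y \<in> space P \<Longrightarrow> mix J x y \<in> space P"
  by (auto simp: mix_def space_PiM PiE_iff extensional_def)

text \<open>
  On a cylinder over \<open>K\<close>, the coordinates in \<open>K \<inter> J\<close> constrain only \<open>x\<close> and those in \<open>K - J\<close> only \<open>y\<close>,
  so the preimage is a rectangle whose measure is the correct product.
\<close>

lemma distr_mix: "distr (P \<Otimes>\<^sub>M P) P (\<lambda>(x, y). mix J x y) = P"
proof (rule PiM_eq)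
  fix K F assume K: "finite K" "K \<subseteq> I" and F: "\<And>j. j \<in> K \<Longrightarrow> F j \<in> sets (M j)"
  let ?C = "\<lambda>L. {x\<in>space P. \<forall>i\<in>L. x i \<in> F i}"
  have meas: "(\<lambda>(x, y). mix J x y) \<in> measurable (P \<Otimes>\<^sub>M P) P"
    unfolding split_beta by measurable
  have sets: "?C L \<in> sets P" if "L \<subseteq> K" for L
  proof -
    have "finite L" using that K(1) finite_subset by blast
    moreover have "Measurable.pred P (\<lambda>x. x i \<in> F i)" if "i \<in> L" for i
    proof -
      have "i \<in> K" "i \<in> I" using that \<open>L \<subseteq> K\<close> K by auto
      then have [measurable]: "F i \<in> sets (M i)" "i \<in> I" using F by auto
      show ?thesis by measurable
    qed
    ultimately show ?thesis by (intro sets.sets_Collect_finite_All) (auto simp: pred_def)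
  qed
  have eq: "emb I K (Pi\<^sub>E K F) = ?C K"
    using K by (auto simp: prod_emb_def space_PiM PiE_iff extensional_def)
  have "(\<lambda>(x, y). mix J x y) -` ?C K \<inter> space (P \<Otimes>\<^sub>M P) = ?C (K \<inter> J) \<times> ?C (K - J)"
    using mix_space[of _ _ J] by (fastforce simp: mix_def space_pair_measure)
  then have "emeasure (distr (P \<Otimes>\<^sub>M P) P (\<lambda>(x, y). mix J x y)) (emb I K (Pi\<^sub>E K F)) =
      emeasure (P \<Otimes>\<^sub>M P) (?C (K \<inter> J) \<times> ?C (K - J))"
    unfolding eq using sets[of K] by (subst emeasure_distr[OF meas]) auto
  also have "\<dots> = (\<Prod>j\<in>K \<inter> J. emeasure (M j) (F j)) * (\<Prod>j\<in>K - J. emeasure (M j) (F j))"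
    using K F
    by (subst P.emeasure_pair_measure_Times) (auto intro!: sets arg_cong2[where f="(*)"] emeasure_PiM_Collect)
  also have "\<dots> = (\<Prod>j\<in>K. emeasure (M j) (F j))"
    using K(1) by (rule prod.Int_Diff[symmetric])
  finally show "emeasure (distr (P \<Otimes>\<^sub>M P) P (\<lambda>(x, y). mix J x y)) (emb I K (Pi\<^sub>E K F)) =
      (\<Prod>j\<in>K. emeasure (M j) (F j))" .
qed simp

lemma measurable_upd:
  assumes "k \<in> I"
  shows "(\<lambda>(x, t). x(k := t)) \<in> measurable (P \<Otimes>\<^sub>M M k) P"
  using measurable_add_dim[of k I M] assms by (simp add: insert_absorb)

lemma measurable_upd2 [measurable]:
  assumes "k \<in> I" "g \<in> measurable N P" "h \<in> measurable N (M k)"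
  shows "(\<lambda>p. (g p)(k := h p)) \<in> measurable N P"
  using measurable_compose[OF measurable_Pair[OF assms(2,3)] measurable_upd[OF assms(1)]] by simp

lemma upd_space: "k \<in> I \<Longrightarrow> x \<in> space P \<Longrightarrow> t \<in> space (M k) \<Longrightarrow> x(k := t) \<in> space P"
  by (auto simp: space_PiM PiE_iff extensional_def)

text \<open>
  Overwriting coordinate \<open>k\<close> by a fresh value is the case \<open>J = I - {k}\<close> of \<open>mix\<close>, where only the
  component \<open>y k\<close> of the second point is seen.
\<close>

lemma distr_upd:
  assumes k: "k \<in> I"
  shows "distr (P \<Otimes>\<^sub>M M k) P (\<lambda>(x, t). x(k := t)) = P"
proof -
  interpret Pk: pair_prob_space P "M k" by unfold_locales
  have dc: "distr P (M k) (\<lambda>y. y k) = M k" using k by (rule PiM_component)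
  have "P \<Otimes>\<^sub>M M k = distr P P (\<lambda>x. x) \<Otimes>\<^sub>M distr P (M k) (\<lambda>y. y k)"
    by (simp add: dc)
  also have "\<dots> = distr (P \<Otimes>\<^sub>M P) (P \<Otimes>\<^sub>M M k) (\<lambda>(x, y). (x, y k))"
    using k M.sigma_finite_measure_axioms[of k] by (intro pair_measure_distr) (auto simp: dc)
  finally have "distr (P \<Otimes>\<^sub>M M k) P (\<lambda>(x, t). x(k := t)) =
     distr (distr (P \<Otimes>\<^sub>M P) (P \<Otimes>\<^sub>M M k) (\<lambda>(x, y). (x, y k))) P (\<lambda>(x, t). x(k := t))" by simp
  also have "\<dots> = distr (P \<Otimes>\<^sub>M P) P ((\<lambda>(x, t). x(k := t)) \<circ> (\<lambda>(x, y). (x, y k)))"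
    using k measurable_upd by (intro distr_distr) (auto simp: split_beta)
  also have "\<dots> = distr (P \<Otimes>\<^sub>M P) P (\<lambda>(x, y). mix (I - {k}) x y)"
    using k
    by (intro distr_cong)
       (auto simp: mix_def space_pair_measure space_PiM PiE_iff extensional_def fun_eq_iff)
  finally show ?thesis by (simp only: distr_mix)
qed

lemma AE_mix:
  assumes "AE x in P. Q x"
  shows "AE x in P. AE y in P. Q (mix J x y)"
proof -
  have T: "(\<lambda>(x, y). mix J x y) \<in> measurable (P \<Otimes>\<^sub>M P) P"
    unfolding split_beta by measurable
  show ?thesis
    using PP.AE_pair[OF AE_distr_eq[OF distr_mix T assms]] by simp
qed

lemma upd_integral:
  fixes f :: "('i \<Rightarrow> 'a) \<Rightarrow> real"
  assumes k: "k \<in> I" and "integrable P f"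
  shows "AE x in P. integrable (M k) (\<lambda>t. f (x(k := t)))"
    and "integrable P (\<lambda>x. \<integral>t. f (x(k := t)) \<partial>M k)"
    and "(\<integral>x. (\<integral>t. f (x(k := t)) \<partial>M k) \<partial>P) = (\<integral>x. f x \<partial>P)"
proof -
  interpret Pk: pair_prob_space P "M k" by unfold_locales
  have [measurable]: "f \<in> borel_measurable P" using assms by auto
  note T = measurable_upd[OF k]
  have int: "integrable (P \<Otimes>\<^sub>M M k) (\<lambda>(x, t). f (x(k := t)))"
    using integral_distr_eq(2)[OF distr_upd[OF k] T, of f] assms by (simp add: split_beta')
  show "AE x in P. integrable (M k) (\<lambda>t. f (x(k := t)))"
    using Pk.AE_integrable_fst'[OF int] by simp
  show "integrable P (\<lambda>x. \<integral>t. f (x(k := t)) \<partial>M k)"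
    using Pk.integrable_fst'[OF int] by simp
  have "(\<integral>x. (\<integral>t. f (x(k := t)) \<partial>M k) \<partial>P) = (\<integral>z. f (case z of (x, t) \<Rightarrow> x(k := t)) \<partial>(P \<Otimes>\<^sub>M M k))"
    using Pk.integral_fst'[OF int] by (simp add: split_beta')
  also have "\<dots> = (\<integral>x. f x \<partial>P)"
    by (rule integral_distr_eq(1)[OF distr_upd[OF k] T]) simp
  finally show "(\<integral>x. (\<integral>t. f (x(k := t)) \<partial>M k) \<partial>P) = (\<integral>x. f x \<partial>P)" .
qed

section \<open>Conditional expectation given a set of coordinates\<close>

definition avg :: "'i set \<Rightarrow> (('i \<Rightarrow> 'a) \<Rightarrow> real) \<Rightarrow> ('i \<Rightarrow> 'a) \<Rightarrow> real" where
  "avg J f x = (\<integral>y. f (mix J x y) \<partial>P)"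

lemma measurable_avg [measurable]:
  assumes [measurable]: "f \<in> borel_measurable P"
  shows "avg J f \<in> borel_measurable P"
  unfolding avg_def by measurable

lemma mix_integral:
  fixes f :: "('i \<Rightarrow> 'a) \<Rightarrow> real"
  assumes "integrable P f"
  shows "AE x in P. integrable P (\<lambda>y. f (mix J x y))"
    and "integrable P (avg J f)"
    and "(\<integral>x. avg J f x \<partial>P) = (\<integral>x. f x \<partial>P)"
proof -
  have [measurable]: "f \<in> borel_measurable P" using assms by auto
  have T: "(\<lambda>(x, y). mix J x y) \<in> measurable (P \<Otimes>\<^sub>M P) P"
    unfolding split_beta by measurable
  have int: "integrable (P \<Otimes>\<^sub>M P) (\<lambda>(x, y). f (mix J x y))"
    using integral_distr_eq(2)[OF distr_mix T, of f] assms by (simp add: split_beta')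
  show "AE x in P. integrable P (\<lambda>y. f (mix J x y))"
    using PP.AE_integrable_fst'[OF int] by simp
  show "integrable P (avg J f)"
    unfolding avg_def using PP.integrable_fst'[OF int] by simp
  have "(\<integral>x. avg J f x \<partial>P) = (\<integral>z. f (case z of (x, y) \<Rightarrow> mix J x y) \<partial>(P \<Otimes>\<^sub>M P))"
    unfolding avg_def using PP.integral_fst'[OF int] by (simp add: split_beta')
  also have "\<dots> = (\<integral>x. f x \<partial>P)"
    by (rule integral_distr_eq(1)[OF distr_mix T]) simp
  finally show "(\<integral>x. avg J f x \<partial>P) = (\<integral>x. f x \<partial>P)" .
qed

lemma avg_remove:
  assumes k: "k \<in> I" and [measurable]: "f \<in> borel_measurable P" and x: "x \<in> space P"
  shows "avg (I - {k}) f x = (\<integral>t. f (x(k := t)) \<partial>M k)"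
proof -
  have "mix (I - {k}) x y = x(k := y k)" if "y \<in> space P" for y
    using that x by (auto simp: mix_def space_PiM PiE_iff extensional_def fun_eq_iff)
  then have "avg (I - {k}) f x = (\<integral>y. f (x(k := y k)) \<partial>P)"
    unfolding avg_def by (intro Bochner_Integration.integral_cong) auto
  also have "\<dots> = (\<integral>t. f (x(k := t)) \<partial>distr P (M k) (\<lambda>y. y k))"
    using k x by (intro integral_distr[symmetric]) auto
  finally show ?thesis using PiM_component[OF k] by simp
qed

lemma avg_upd_outside: "j \<notin> J \<Longrightarrow> avg J f (x(j := t)) = avg J f x"
proof -
  assume "j \<notin> J"
  then have "mix J (x(j := t)) y = mix J x y" for y by (auto simp: mix_def fun_eq_iff)
  then show ?thesis by (simp add: avg_def)
qed

text \<open>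
  This expresses that \<open>u\<close> depends on the coordinates in \<open>J\<close> alone, everywhere and not just almost
  everywhere, so that such functions can be pulled out of \<open>avg J\<close> pointwise.
\<close>

definition determined :: "'i set \<Rightarrow> (('i \<Rightarrow> 'a) \<Rightarrow> real) \<Rightarrow> bool" where
  "determined J u \<longleftrightarrow> (\<forall>x\<in>space P. \<forall>y\<in>space P. u (mix J x y) = u x)"

lemma determined_avg: "K \<subseteq> J \<Longrightarrow> determined J (avg K f)"
proof -
  assume "K \<subseteq> J"
  then have "mix K (mix J x y) z = mix K x z" for x y z :: "'i \<Rightarrow> 'a"
    by (auto simp: mix_def fun_eq_iff)
  then show ?thesis by (simp add: determined_def avg_def)
qed

lemma determined_mono:
  assumes "determined J u" "J \<subseteq> K"
  shows "determined K u"
  unfolding determined_def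
proof safe
  fix x y assume x: "x \<in> space P" and y: "y \<in> space P"
  have "mix J (mix K x y) y = mix J x y" using assms(2) by (auto simp: mix_def fun_eq_iff)
  then show "u (mix K x y) = u x"
    using assms(1) x y mix_space[OF x y, of K] by (metis determined_def)
qed

lemma avg_pull_out:
  assumes "determined J u" "x \<in> space P"
  shows "avg J (\<lambda>x. u x * v x) x = u x * avg J v x"
proof -
  have "avg J (\<lambda>x. u x * v x) x = (\<integral>y. u x * v (mix J x y) \<partial>P)"
    unfolding avg_def using assms by (intro Bochner_Integration.integral_cong) (auto simp: determined_def)
  then show ?thesis by (simp add: avg_def)
qed

lemma integral_mult_avg:
  assumes "determined J u" "integrable P (\<lambda>x. u x * v x)"
  shows "integrable P (\<lambda>x. u x * avg J v x)"
    and "(\<integral>x. u x * avg J v x \<partial>P) = (\<integral>x. u x * v x \<partial>P)"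
proof -
  have eq: "u x * avg J v x = avg J (\<lambda>x. u x * v x) x" if "x \<in> space P" for x
    using avg_pull_out[OF assms(1) that] by simp
  show "integrable P (\<lambda>x. u x * avg J v x)"
    using mix_integral(2)[OF assms(2), of J] eq by (subst Bochner_Integration.integrable_cong[OF refl]) auto
  show "(\<integral>x. u x * avg J v x \<partial>P) = (\<integral>x. u x * v x \<partial>P)"
    using mix_integral(3)[OF assms(2), of J] eq
    by (simp cong: Bochner_Integration.integral_cong)
qed

text \<open>
  Resampling twice keeps exactly the coordinates in \<open>J \<inter> K\<close> and replaces the others by those of
  \<open>mix J y z\<close>, which is distributed like a single fresh point.
\<close>

lemma avg_avg:
  assumes "integrable P f"
  shows "AE x in P. avg K (avg J f) x = avg (J \<inter> K) f x"
proof -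
  have [measurable]: "f \<in> borel_measurable P" using assms by auto
  have T: "(\<lambda>(x, y). mix J x y) \<in> measurable (P \<Otimes>\<^sub>M P) P"
    unfolding split_beta by measurable
  from mix_integral(1)[OF assms, of "J \<inter> K"] AE_space show ?thesis
  proof eventually_elim
    case (elim x)
    have [measurable]: "x \<in> space P" using elim by simp
    let ?g = "\<lambda>y. f (mix (J \<inter> K) x y)"
    have int: "integrable (P \<Otimes>\<^sub>M P) (\<lambda>(y, z). ?g (mix J y z))"
      using integral_distr_eq(2)[OF distr_mix T, of ?g] elim by (simp add: split_beta')
    have "avg K (avg J f) x = (\<integral>y. \<integral>z. ?g (mix J y z) \<partial>P \<partial>P)"
      unfolding avg_def mix_mix_left ..
    also have "\<dots> = (\<integral>z. ?g (case z of (x, y) \<Rightarrow> mix J x y) \<partial>(P \<Otimes>\<^sub>M P))"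
      using PP.integral_fst'[OF int] by (simp add: split_beta')
    also have "\<dots> = (\<integral>x. ?g x \<partial>P)"
      by (rule integral_distr_eq(1)[OF distr_mix T]) simp
    finally show ?case by (simp add: avg_def)
  qed
qed

lemma avg_compl_determined:
  assumes "determined J f" and [measurable]: "f \<in> borel_measurable P" and x: "x \<in> space P"
  shows "avg (I - J) f x = (\<integral>y. f y \<partial>P)"
proof -
  have "mix (I - J) x y = mix J y x" if "y \<in> space P" for y
    using that x by (auto simp: mix_def space_PiM PiE_iff extensional_def fun_eq_iff)
  then show ?thesis
    unfolding avg_def using assms by (intro Bochner_Integration.integral_cong) (auto simp: determined_def)
qed

lemma L2_integrable: "f \<in> L2 P \<Longrightarrow> integrable P f"
  by (auto simp: L2_def intro: P.square_integrable_imp_integrable)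

lemma avg_square_le:
  assumes "f \<in> L2 P"
  shows "AE x in P. (avg J f x)\<^sup>2 \<le> avg J (\<lambda>x. (f x)\<^sup>2) x"
proof -
  have [measurable]: "f \<in> borel_measurable P" using assms by (auto simp: L2_def)
  have "integrable P (\<lambda>x. (f x)\<^sup>2)" using assms by (auto simp: L2_def)
  from mix_integral(1)[OF this, of J] mix_integral(1)[OF L2_integrable[OF assms], of J] AE_space
  show ?thesis
  proof eventually_elim
    case (elim x)
    have "0 \<le> P.variance (\<lambda>y. f (mix J x y))" by (rule P.variance_positive)
    also have "\<dots> = avg J (\<lambda>x. (f x)\<^sup>2) x - (avg J f x)\<^sup>2"
      using elim by (subst P.variance_eq) (auto simp: avg_def)
    finally show ?case by simp
  qed
qed

lemma avg_L2:
  assumes "f \<in> L2 P"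
  shows "avg J f \<in> L2 P" "(\<integral>x. (avg J f x)\<^sup>2 \<partial>P) \<le> (\<integral>x. (f x)\<^sup>2 \<partial>P)"
proof -
  have [measurable]: "f \<in> borel_measurable P" and i: "integrable P (\<lambda>x. (f x)\<^sup>2)"
    using assms by (auto simp: L2_def)
  have int: "integrable P (\<lambda>x. (avg J f x)\<^sup>2)"
    using mix_integral(2)[OF i, of J]
  proof (rule Bochner_Integration.integrable_bound)
    show "AE x in P. norm ((avg J f x)\<^sup>2) \<le> norm (avg J (\<lambda>x. (f x)\<^sup>2) x)"
      using avg_square_le[OF assms, of J] by eventually_elim auto
  qed measurable
  then show "avg J f \<in> L2 P" by (simp add: L2_def)
  show "(\<integral>x. (avg J f x)\<^sup>2 \<partial>P) \<le> (\<integral>x. (f x)\<^sup>2 \<partial>P)"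
    unfolding mix_integral(3)[OF i, of J, symmetric]
    by (intro integral_mono_AE int mix_integral(2) i avg_square_le assms)
qed

lemma avg_abs_le:
  assumes "integrable P f"
  shows "(\<integral>x. \<bar>avg J f x\<bar> \<partial>P) \<le> (\<integral>x. \<bar>f x\<bar> \<partial>P)"
proof -
  have i: "integrable P (\<lambda>x. \<bar>f x\<bar>)" using assms by simp
  have "(\<integral>x. \<bar>avg J f x\<bar> \<partial>P) \<le> (\<integral>x. avg J (\<lambda>x. \<bar>f x\<bar>) x \<partial>P)"
    by (intro integral_mono integrable_abs mix_integral(2) i assms)
       (auto simp: avg_def intro: integral_abs_bound)
  then show ?thesis using mix_integral(3)[OF i] by simp
qed

lemma avg_pythagoras:
  assumes f: "f \<in> L2 P" and KJ: "K \<subseteq> J"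
  shows "(\<integral>x. (avg J f x - avg K f x)\<^sup>2 \<partial>P) = (\<integral>x. (avg J f x)\<^sup>2 \<partial>P) - (\<integral>x. (avg K f x)\<^sup>2 \<partial>P)"
proof -
  have i: "integrable P (\<lambda>x. avg K f x * f x)" by (intro L2_mult avg_L2 f)
  have "(\<integral>x. avg K f x * avg J f x \<partial>P) = (\<integral>x. avg K f x * avg K f x \<partial>P)"
    using integral_mult_avg(2)[OF determined_avg[OF KJ] i]
      integral_mult_avg(2)[OF determined_avg[of K K] i] by simp
  moreover have "integrable P (\<lambda>x. (avg J f x)\<^sup>2)" "integrable P (\<lambda>x. (avg K f x)\<^sup>2)"
    "integrable P (\<lambda>x. avg K f x * avg J f x)"
    using avg_L2[OF f] L2_mult[OF avg_L2(1)[OF f] avg_L2(1)[OF f]] by (auto simp: L2_def)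
  moreover have "(\<lambda>x. (avg J f x - avg K f x)\<^sup>2) =
      (\<lambda>x. (avg J f x)\<^sup>2 + (avg K f x)\<^sup>2 - 2 * (avg K f x * avg J f x))"
    by (simp add: power2_diff mult_ac)
  ultimately show ?thesis by (simp add: power2_eq_square)
qed

end

section \<open>Truncation and entropy on one space\<close>

text \<open>
  The Bregman divergence of \<open>\<lambda>x. x * ln x\<close>. For a function \<open>w\<close> on a probability space, the mean of
  \<open>bregman (w x) m\<close> is least when \<open>m\<close> is the mean of \<open>w\<close>, and is then the entropy of \<open>w\<close>.
\<close>

definition bregman :: "real \<Rightarrow> real \<Rightarrow> real" where
  "bregman w m = w * ln (w / m) - w + m"

lemma mult_ln_ge:
  fixes w m :: real
  assumes "0 \<le> w" "0 < m"
  shows "w - m \<le> w * ln (w / m)"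
proof (cases "w = 0")
  case False
  then have w: "0 < w" using assms by simp
  have "ln (m / w) \<le> m / w - 1" using w assms by (intro ln_le_minus_one) auto
  then have "w * ln (m / w) \<le> w * (m / w - 1)" using w by (intro mult_left_mono) auto
  then show ?thesis using w assms by (simp add: ln_div algebra_simps)
qed (use assms in simp)

text \<open>
  The divergence decreases when one argument is moved towards the other; this is what makes it
  compatible with truncation.
\<close>

lemma bregman_between:
  assumes "0 \<le> w" "0 < t" "0 < m" and t: "w \<le> t \<and> t \<le> m \<or> m \<le> t \<and> t \<le> w"
  shows "bregman w t \<le> bregman w m" and "bregman t m \<le> bregman w m"
proof -
  have 1: "t - m \<le> w * ln (t / m)"
  proof (cases "w \<le> t \<and> t \<le> m")
    case True
    have "ln (m / t) \<le> m / t - 1" using assms by (intro ln_le_minus_one) auto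
    then have "w * ln (m / t) \<le> w * (m / t - 1)" using assms by (intro mult_left_mono) auto
    also have "\<dots> \<le> t * (m / t - 1)" using True assms by (intro mult_right_mono) auto
    finally show ?thesis using assms by (simp add: ln_div algebra_simps)
  next
    case False
    then have le: "m \<le> t" "t \<le> w" using t by auto
    then have "t * ln (t / m) \<le> w * ln (t / m)" using assms by (intro mult_right_mono ln_ge_zero) auto
    then show ?thesis using mult_ln_ge[of t m] assms by simp
  qed
  have "w * ln (w / m) = w * ln (w / t) + w * ln (t / m)"
    using assms by (cases "w = 0") (auto simp: ln_div algebra_simps)
  note eq = this
  show "bregman w t \<le> bregman w m" using 1 eq by (simp add: bregman_def)
  have "0 \<le> (w - t) * ln (t / m)"
  proof (cases "w \<le> t \<and> t \<le> m")
    case True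
    then have "ln (t / m) \<le> 0" using assms by (simp add: ln_le_zero_iff)
    then show ?thesis using True by (simp add: mult_nonpos_nonpos)
  next
    case False
    then show ?thesis using assms by (intro mult_nonneg_nonneg ln_ge_zero) auto
  qed
  then show "bregman t m \<le> bregman w m"
    using eq mult_ln_ge[of w t] assms by (simp add: bregman_def algebra_simps)
qed

definition clamp_on :: "real \<Rightarrow> real \<Rightarrow> real \<Rightarrow> real" where
  "clamp_on a b x = max a (min b x)"

lemma clamp_on_range: "a \<le> b \<Longrightarrow> a \<le> clamp_on a b x \<and> clamp_on a b x \<le> b"
  by (auto simp: clamp_on_def)

lemma measurable_clamp_on [measurable]:
  "f \<in> borel_measurable N \<Longrightarrow> (\<lambda>x. clamp_on a b (f x)) \<in> borel_measurable N"
  unfolding clamp_on_def by (intro borel_measurable_max borel_measurable_min borel_measurable_const)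

lemma clamp_on_square:
  assumes "0 < a" "a \<le> b"
  shows "(clamp_on a b \<bar>x\<bar>)\<^sup>2 = clamp_on (a\<^sup>2) (b\<^sup>2) (x\<^sup>2)"
proof -
  have "max a y ^ 2 = max (a\<^sup>2) (y\<^sup>2)" if "0 \<le> y" for y
    using assms that by (cases "a \<le> y") (auto simp: max_def dest: power2_le_imp_le intro: power_mono)
  moreover have "min b \<bar>x\<bar> ^ 2 = min (b\<^sup>2) (x\<^sup>2)"
  proof (cases "b \<le> \<bar>x\<bar>")
    case True
    then have "b\<^sup>2 \<le> \<bar>x\<bar>\<^sup>2" using assms by (intro power_mono) auto
    then show ?thesis using True by simp
  next
    case False
    then have "\<bar>x\<bar>\<^sup>2 \<le> b\<^sup>2" using assms by (intro power_mono) auto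
    then show ?thesis using False by simp
  qed
  ultimately show ?thesis using assms by (simp add: clamp_on_def)
qed

lemma clamp_on_tendsto:
  assumes "0 \<le> (y::real)"
  shows "(\<lambda>n. clamp_on (1 / real (Suc n)) (real (Suc n)) y) \<longlonglongrightarrow> y"
proof -
  have "eventually (\<lambda>n. y \<le> real (Suc n)) sequentially"
    using eventually_ge_at_top[of "nat \<lceil>y\<rceil>"] by eventually_elim linarith
  then have "eventually (\<lambda>n. max (1 / real (Suc n)) y = clamp_on (1 / real (Suc n)) (real (Suc n)) y) sequentially"
    by eventually_elim (simp add: clamp_on_def)
  moreover have "(\<lambda>n. max (1 / real (Suc n)) y) \<longlonglongrightarrow> max 0 y"
    by (intro tendsto_max tendsto_const LIMSEQ_Suc lim_1_over_n)
  ultimately show ?thesis using assms by (auto intro: Lim_transform_eventually)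
qed

lemma bregman_self: "0 < t \<Longrightarrow> bregman t t = 0"
  by (simp add: bregman_def)

lemma bregman_nonneg: "0 \<le> w \<Longrightarrow> 0 < m \<Longrightarrow> 0 \<le> bregman w m"
  using mult_ln_ge[of w m] by (simp add: bregman_def)

lemma bregman_clamp_on:
  assumes "0 < a" "a \<le> b" "0 \<le> w" "0 < m"
  shows "bregman (clamp_on a b w) (clamp_on a b m) \<le> bregman w m"
proof -
  have min: "bregman (min b w) (min b m) \<le> bregman w m"
    using assms bregman_between[of w b m] bregman_self[of b] bregman_nonneg[of w m]
    by (cases "w \<le> b"; cases "m \<le> b") (auto simp: min_def)
  have "bregman (max a v) (max a n) \<le> bregman v n" if "0 \<le> v" "0 < n" for v n
    using assms that bregman_between[of v a n] bregman_self[of a] bregman_nonneg[of v n]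
    by (cases "a \<le> v"; cases "a \<le> n") (auto simp: max_def)
  from this[of "min b w" "min b m"] min show ?thesis
    using assms by (simp add: clamp_on_def)
qed

context prob_space
begin

lemma integrable_bounded:
  fixes u :: "'a \<Rightarrow> real"
  assumes "u \<in> borel_measurable M" "\<And>x. x \<in> space M \<Longrightarrow> \<bar>u x\<bar> \<le> C"
  shows "integrable M u"
  using assms by (intro integrable_const_bound[of _ C]) (auto intro!: AE_I2)

lemma integrable_mult_ln:
  fixes u v w :: "'a \<Rightarrow> real"
  assumes [measurable]: "w \<in> borel_measurable M" "u \<in> borel_measurable M" "v \<in> borel_measurable M"
    and ab: "0 < a"
    and w: "\<And>x. x \<in> space M \<Longrightarrow> a \<le> w x \<and> w x \<le> b"
    and u: "\<And>x. x \<in> space M \<Longrightarrow> a \<le> u x \<and> u x \<le> b"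
    and v: "\<And>x. x \<in> space M \<Longrightarrow> a \<le> v x \<and> v x \<le> b"
  shows "integrable M (\<lambda>x. w x * ln (u x / v x))"
proof (rule integrable_bounded)
  fix x assume x: "x \<in> space M"
  have "ln a \<le> ln (u x)" "ln (u x) \<le> ln b" "ln a \<le> ln (v x)" "ln (v x) \<le> ln b"
    using u[OF x] v[OF x] ab by auto
  moreover have "ln (u x / v x) = ln (u x) - ln (v x)"
    using u[OF x] v[OF x] ab by (simp add: ln_div)
  ultimately have "\<bar>ln (u x / v x)\<bar> \<le> ln b - ln a" by simp
  moreover have "\<bar>w x\<bar> \<le> b" using w[OF x] ab by simp
  ultimately show "\<bar>w x * ln (u x / v x)\<bar> \<le> b * (ln b - ln a)"
    using w[OF x] ab by (simp add: abs_mult mult_mono)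
qed measurable

text \<open>
  Truncating both a function and its mean decreases the divergence pointwise. The truncated mean is
  not the mean of the truncated function, but replacing the former by the latter decreases the
  integral further.
\<close>

lemma clamp_entropy_le:
  assumes u: "u \<in> L2 M" and ent: "Ent M (\<lambda>x. (u x)\<^sup>2) \<le> ereal B" and ab: "0 < a" "a \<le> b"
  defines "h \<equiv> (\<lambda>x. clamp_on a b ((u x)\<^sup>2))"
  shows "(\<integral>x. h x * ln (h x / (\<integral>x. h x \<partial>M)) \<partial>M) \<le> B"
proof -
  have [measurable]: "u \<in> borel_measurable M" and u2: "integrable M (\<lambda>x. (u x)\<^sup>2)"
    using u by (auto simp: L2_def)
  have [measurable]: "h \<in> borel_measurable M" unfolding h_def by measurable
  have hr: "a \<le> h x \<and> h x \<le> b" for x using clamp_on_range ab by (simp add: h_def)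
  have hi: "integrable M h"
  proof (rule integrable_bounded[of _ b])
    show "\<bar>h x\<bar> \<le> b" for x using hr[of x] ab by (simp add: abs_le_iff)
  qed measurable
  define H where "H = (\<integral>x. h x \<partial>M)"
  have Ha: "a \<le> H" unfolding H_def using hr hi by (intro integral_ge_const) auto
  have Hb: "H \<le> b" unfolding H_def using hr hi by (intro integral_le_const) auto
  have hln: "integrable M (\<lambda>x. h x * ln (h x / t))" if "a \<le> t" "t \<le> b" for t
    using hr that ab by (intro integrable_mult_ln[of h h "\<lambda>_. t" a b]) auto
  let ?w = "\<lambda>x. (u x)\<^sup>2"
  define m where "m = (\<integral>x. ?w x \<partial>M)"
  have wl: "integrable M (\<lambda>x. ?w x * ln (?w x))"
    and eB: "(\<integral>x. ?w x * ln (?w x) \<partial>M) - m * ln m \<le> B"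
    using ent by (auto simp: Ent_def m_def split: if_splits)
  have m0: "0 \<le> m" unfolding m_def by simp
  show ?thesis
  proof (cases "m = 0")
    case True
    then have "AE x in M. ?w x = 0"
      unfolding m_def using integral_nonneg_eq_0_iff_AE[OF u2] by simp
    then have z: "AE x in M. u x = 0" by simp
    have ha: "AE x in M. h x = a" using z by eventually_elim (use ab in \<open>auto simp: h_def clamp_on_def\<close>)
    then have "H = a" unfolding H_def
      by (subst integral_cong_AE[where g="\<lambda>_. a"]) (auto simp: prob_space)
    with ha have "AE x in M. h x * ln (h x / H) = 0" using ab by auto
    then have "(\<integral>x. h x * ln (h x / H) \<partial>M) = 0" by (rule integral_eq_zero_AE)
    moreover have "(\<integral>x. ?w x * ln (?w x) \<partial>M) = 0"
      using z by (intro integral_eq_zero_AE) auto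
    ultimately show ?thesis using eB True by (simp add: H_def)
  next
    case False
    then have m: "0 < m" using m0 by simp
    define t where "t = clamp_on a b m"
    have t: "a \<le> t" "t \<le> b" "0 < t" using clamp_on_range[of a b m] ab by (auto simp: t_def)
    \<comment> \<open>both sides are integrals of Bregman divergences, the left one up to a nonnegative error from the choice of \<open>t\<close>\<close>
    have weq: "bregman (?w x) m = ?w x * ln (?w x) - ln m * ?w x - ?w x + m" for x
      using m by (cases "u x = 0") (auto simp: bregman_def ln_div algebra_simps)
    have heq: "bregman (h x) t = h x * ln (h x / H) + ln (H / t) * h x - h x + t" for x
      using hr[of x] t Ha ab by (auto simp: bregman_def ln_div algebra_simps)
    have "(\<integral>x. bregman (h x) t \<partial>M) \<le> (\<integral>x. bregman (?w x) m \<partial>M)"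
    proof (intro integral_mono)
      show "integrable M (\<lambda>x. bregman (h x) t)" using hln[of H] Ha Hb hi by (simp add: heq)
      show "integrable M (\<lambda>x. bregman (?w x) m)" using wl u2 by (simp add: weq)
    qed (use bregman_clamp_on m ab in \<open>auto simp: h_def t_def\<close>)
    also have "(\<integral>x. bregman (?w x) m \<partial>M) = (\<integral>x. ?w x * ln (?w x) \<partial>M) - m * ln m"
      using wl u2 by (simp add: weq prob_space m_def[symmetric])
    also have "(\<integral>x. bregman (h x) t \<partial>M) = (\<integral>x. h x * ln (h x / H) \<partial>M) + bregman H t"
      unfolding heq using hln[of H] Ha Hb hi
      by (simp add: prob_space H_def[symmetric] bregman_def[of H])
    finally have "(\<integral>x. h x * ln (h x / H) \<partial>M) + bregman H t \<le> (\<integral>x. ?w x * ln (?w x) \<partial>M) - m * ln m" .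
    moreover have "0 \<le> bregman H t" using Ha ab t by (intro bregman_nonneg) auto
    ultimately show ?thesis using eB by (simp add: H_def)
  qed
qed

text \<open>
  Under the probability density \<open>c\<^sup>2 / H\<close> the mean of \<open>1 / c\<close> is \<open>\<integral> c / H\<close>, and Jensen's inequality for
  the logarithm of \<open>1 / c\<close> gives the claim.
\<close>

lemma entropy_square_lower_bound:
  assumes [measurable]: "c \<in> borel_measurable M" and a: "0 < a"
    and c: "\<And>x. x \<in> space M \<Longrightarrow> a \<le> c x \<and> c x \<le> (b::real)"
  defines "H \<equiv> (\<integral>x. (c x)\<^sup>2 \<partial>M)"
  shows "H * ln (H / (\<integral>x. c x \<partial>M)\<^sup>2) \<le> (\<integral>x. (c x)\<^sup>2 * ln ((c x)\<^sup>2 / H) \<partial>M)"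
proof -
  define m where "m = (\<integral>x. c x \<partial>M)"
  have ci: "integrable M c"
    by (rule integrable_bounded[of _ b]) (use c a in fastforce)+
  have sq: "a\<^sup>2 \<le> (c x)\<^sup>2 \<and> (c x)\<^sup>2 \<le> b\<^sup>2" if "x \<in> space M" for x
    using c[OF that] a by (auto intro!: power_mono)
  have c2i: "integrable M (\<lambda>x. (c x)\<^sup>2)"
    using sq by (intro integrable_bounded[of _ "b\<^sup>2"]) auto
  have m: "a \<le> m" unfolding m_def using ci c by (intro integral_ge_const AE_I2) auto
  have H: "a\<^sup>2 \<le> H" unfolding H_def using c2i sq by (intro integral_ge_const AE_I2) auto
  have Hb: "H \<le> b\<^sup>2" unfolding H_def using c2i sq by (intro integral_le_const AE_I2) auto
  have pos: "0 < m" "0 < H" using m H a by (auto intro: less_le_trans[of _ "a\<^sup>2"])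
  have "H * ln (H / m\<^sup>2) = (\<integral>x. ln (H / m\<^sup>2) * (c x)\<^sup>2 + 2 * (c x)\<^sup>2 - 2 * H / m * c x \<partial>M)"
    using ci c2i pos by (simp add: H_def[symmetric] m_def[symmetric])
  also have "\<dots> \<le> (\<integral>x. (c x)\<^sup>2 * ln ((c x)\<^sup>2 / H) \<partial>M)"
  proof (rule integral_mono)
    show "integrable M (\<lambda>x. (c x)\<^sup>2 * ln ((c x)\<^sup>2 / H))"
      using sq H Hb a by (intro integrable_mult_ln[of _ _ "\<lambda>_. H" "a\<^sup>2" "b\<^sup>2"]) auto
    fix x assume x: "x \<in> space M"
    have cx: "0 < c x" using c[OF x] a by simp
    \<comment> \<open>the tangent of \<open>\<lambda>x. x * ln x\<close> at \<open>H / m\<close> leaves \<open>2 * (c x)\<^sup>2 - 2 * H / m * c x\<close>, whose integral is zero\<close>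
    have "c x - H / m \<le> c x * ln (c x / (H / m))"
      using cx pos by (intro mult_ln_ge) auto
    then have "2 * c x * (c x - H / m) \<le> 2 * c x * (c x * ln (c x / (H / m)))"
      using cx by (intro mult_left_mono) auto
    moreover have "2 * ln (c x / (H / m)) = ln ((c x)\<^sup>2 / H) - ln (H / m\<^sup>2)"
      using cx pos by (simp add: ln_div ln_mult ln_realpow)
    moreover have "2 * c x * (c x * ln (c x / (H / m))) = (c x)\<^sup>2 * (2 * ln (c x / (H / m)))"
      by (simp add: power2_eq_square)
    ultimately have "2 * c x * (c x - H / m) \<le> (c x)\<^sup>2 * (ln ((c x)\<^sup>2 / H) - ln (H / m\<^sup>2))"
      by simp
    then show "ln (H / m\<^sup>2) * (c x)\<^sup>2 + 2 * (c x)\<^sup>2 - 2 * H / m * c x \<le> (c x)\<^sup>2 * ln ((c x)\<^sup>2 / H)"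
      by (simp add: algebra_simps power2_eq_square)
  qed (use ci c2i in simp)
  finally show ?thesis by (simp add: m_def)
qed

end

section \<open>Subadditivity of entropy over coordinates\<close>

text \<open>
  The tangent of the jointly convex function \<open>\<lambda>(h, t). h * ln (h / t)\<close> at \<open>(a, b)\<close>.
\<close>

lemma mult_ln_tangent:
  fixes h :: real
  assumes "0 < h" "0 < t" "0 < a" "0 < b"
  shows "h * ln (a / b) \<le> h * ln (h / t) - h + t / b * a"
proof -
  \<comment> \<open>homogeneity reduces the claim to one comparison with the value \<open>t a / b\<close>\<close>
  have "h - t / b * a \<le> h * ln (h / (t / b * a))" using assms by (intro mult_ln_ge) auto
  also have "\<dots> = h * ln (h / t) - h * ln (a / b)"
    using assms by (simp add: ln_div ln_mult algebra_simps)
  finally show ?thesis by simp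
qed

context product_prob_space
begin

lemma avg_range:
  assumes [measurable]: "h \<in> borel_measurable P"
    and h: "\<And>x. x \<in> space P \<Longrightarrow> a \<le> h x \<and> h x \<le> (b::real)" and x: "x \<in> space P"
  shows "a \<le> avg J h x \<and> avg J h x \<le> b"
proof -
  have r: "a \<le> h (mix J x y) \<and> h (mix J x y) \<le> b" if "y \<in> space P" for y
    using h mix_space[OF x that] by blast
  have [measurable]: "x \<in> space P" by fact
  have "integrable P (\<lambda>y. h (mix J x y))"
    by (rule P.integrable_bounded[of _ "max \<bar>a\<bar> \<bar>b\<bar>"]) (use r in force)+
  then show ?thesis
    unfolding avg_def using r by (auto intro!: P.integral_ge_const P.integral_le_const AE_I2)
qed

text \<open>
  The entropy lost when coordinate \<open>k\<close> is averaged out of \<open>avg K h\<close> is at most the entropy of \<open>h\<close>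
  itself in coordinate \<open>k\<close>. This is Jensen's inequality for a jointly convex function, carried out
  by integrating the tangent inequality.
\<close>

lemma entropy_tensor_step:
  assumes [measurable]: "h \<in> borel_measurable P"
    and h: "\<And>x. x \<in> space P \<Longrightarrow> a \<le> h x \<and> h x \<le> b" and a: "0 < a" and K: "K \<subseteq> I"
  shows "(\<integral>x. h x * ln (avg K h x / avg (K - {k}) h x) \<partial>P) \<le> (\<integral>x. h x * ln (h x / avg (I - {k}) h x) \<partial>P)"
proof -
  have bnd: "\<bar>u x\<bar> \<le> b" if "\<And>x. x \<in> space P \<Longrightarrow> a \<le> u x \<and> u x \<le> b" "x \<in> space P" for u x
    using that a by fastforce
  have hi: "integrable P h" by (rule P.integrable_bounded[of _ b]) (use h bnd in auto)
  have ra: "a \<le> avg J h x \<and> avg J h x \<le> b" if "x \<in> space P" for x J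
    using avg_range[of h a b x J] h that by auto
  let ?t = "avg (I - {k}) h" and ?b = "avg (K - {k}) h"
  have ab: "0 < b" if "x \<in> space P" for x using h[OF that] a by simp
  have u: "determined (I - {k}) (\<lambda>x. ?t x / ?b x)"
    using determined_avg[of "I - {k}" "I - {k}" h] determined_avg[of "K - {k}" "I - {k}" h] K
    by (auto simp: determined_def)
  have int: "integrable P (\<lambda>x. ?t x / ?b x * avg K h x)"
  proof (rule P.integrable_bounded[of _ "b / a * b"])
    fix x assume x: "x \<in> space P"
    show "\<bar>?t x / ?b x * avg K h x\<bar> \<le> b / a * b"
      using ra[OF x, of "I - {k}"] ra[OF x, of "K - {k}"] ra[OF x, of K] a
      by (auto simp: abs_mult intro!: mult_mono frac_le)
  qed measurable
  \<comment> \<open>the weight \<open>?t / ?b\<close> is independent of coordinate \<open>k\<close>, and averaging \<open>avg K h\<close> over \<open>k\<close> gives \<open>?b\<close>\<close>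
  have "(\<integral>x. ?t x / ?b x * avg K h x \<partial>P) = (\<integral>x. ?t x / ?b x * avg (I - {k}) (avg K h) x \<partial>P)"
    using integral_mult_avg(2)[OF u int] by simp
  also have "\<dots> = (\<integral>x. ?t x \<partial>P)"
  proof (rule integral_cong_AE)
    have "K \<inter> (I - {k}) = K - {k}" using K by auto
    then have "AE x in P. avg (I - {k}) (avg K h) x = ?b x"
      using avg_avg[OF hi, of "I - {k}" K] by simp
    then show "AE x in P. ?t x / ?b x * avg (I - {k}) (avg K h) x = ?t x"
      using AE_space
    proof eventually_elim
      case (elim x)
      then show ?case using ra[of x "K - {k}"] a by auto
    qed
  qed measurable
  also have "\<dots> = (\<integral>x. h x \<partial>P)" by (rule mix_integral(3)[OF hi])
  finally have eq: "(\<integral>x. ?t x / ?b x * avg K h x \<partial>P) = (\<integral>x. h x \<partial>P)" .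
  have i1: "integrable P (\<lambda>x. h x * ln (avg K h x / ?b x))"
    using h ra a by (intro P.integrable_mult_ln[of h _ _ a b]) auto
  have i2: "integrable P (\<lambda>x. h x * ln (h x / ?t x))"
    using h ra a by (intro P.integrable_mult_ln[of h _ _ a b]) auto
  have "(\<integral>x. h x * ln (avg K h x / ?b x) \<partial>P) \<le> (\<integral>x. h x * ln (h x / ?t x) - h x + ?t x / ?b x * avg K h x \<partial>P)"
  proof (rule integral_mono)
    fix x assume x: "x \<in> space P"
    have "0 < h x" "0 < ?t x" "0 < avg K h x" "0 < ?b x"
      using h[OF x] ra[OF x, of "I - {k}"] ra[OF x, of "K - {k}"] ra[OF x, of K] a by auto
    then show "h x * ln (avg K h x / ?b x) \<le> h x * ln (h x / ?t x) - h x + ?t x / ?b x * avg K h x"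
      by (rule mult_ln_tangent)
  qed (use i1 i2 hi int in auto)
  also have "\<dots> = (\<integral>x. h x * ln (h x / ?t x) \<partial>P)"
    using i2 hi int eq by simp
  finally show ?thesis .
qed

text \<open>
  The quotient \<open>h / avg (I - J) h\<close> factors into the successive quotients that arise by averaging out
  the coordinates of \<open>J\<close> one after the other.
\<close>

lemma entropy_tensorization:
  assumes "finite J" "J \<subseteq> I" and [measurable]: "h \<in> borel_measurable P"
    and h: "\<And>x. x \<in> space P \<Longrightarrow> a \<le> h x \<and> h x \<le> b" and a: "0 < a"
  shows "(\<integral>x. h x * ln (h x / avg (I - J) h x) \<partial>P) \<le> (\<Sum>k\<in>J. \<integral>x. h x * ln (h x / avg (I - {k}) h x) \<partial>P)"
  using assms(1,2)
proof (induction J)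
  case empty
  have "avg I h x = h x" if "x \<in> space P" for x
  proof -
    have "mix I x y = x" if "y \<in> space P" for y
      using that \<open>x \<in> space P\<close> by (auto simp: mix_def space_PiM PiE_iff extensional_def fun_eq_iff)
    then have "avg I h x = (\<integral>y. h x \<partial>P)"
      unfolding avg_def by (intro Bochner_Integration.integral_cong) auto
    then show ?thesis by (simp add: P.prob_space)
  qed
  moreover have "h x \<noteq> 0" if "x \<in> space P" for x using h[OF that] a by auto
  ultimately have "(\<integral>x. h x * ln (h x / avg I h x) \<partial>P) = (\<integral>x. 0 \<partial>P)"
    by (intro Bochner_Integration.integral_cong) auto
  then show ?case by simp
next
  case (insert k J)
  have ra: "a \<le> avg J h x \<and> avg J h x \<le> b" if "x \<in> space P" for x J
    using avg_range[of h a b x J] h that by auto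
  have del: "I - insert k J = I - J - {k}" by auto
  have i: "integrable P (\<lambda>x. h x * ln (h x / avg (I - J) h x))"
    "integrable P (\<lambda>x. h x * ln (avg (I - J) h x / avg (I - J - {k}) h x))"
    using h ra a by (auto intro!: P.integrable_mult_ln[of h _ _ a b])
  have "(\<integral>x. h x * ln (h x / avg (I - insert k J) h x) \<partial>P) =
      (\<integral>x. h x * ln (h x / avg (I - J) h x) + h x * ln (avg (I - J) h x / avg (I - J - {k}) h x) \<partial>P)"
  proof (rule Bochner_Integration.integral_cong[OF refl])
    fix x assume x: "x \<in> space P"
    have "0 < h x" "0 < avg (I - J) h x" "0 < avg (I - J - {k}) h x"
      using h[OF x] ra[OF x, of "I - J"] ra[OF x, of "I - J - {k}"] a by auto
    then show "h x * ln (h x / avg (I - insert k J) h x) =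
       h x * ln (h x / avg (I - J) h x) + h x * ln (avg (I - J) h x / avg (I - J - {k}) h x)"
      unfolding del by (simp add: ln_div algebra_simps)
  qed
  also have "\<dots> = (\<integral>x. h x * ln (h x / avg (I - J) h x) \<partial>P) +
      (\<integral>x. h x * ln (avg (I - J) h x / avg (I - J - {k}) h x) \<partial>P)"
    using i by simp
  also have "\<dots> \<le> (\<Sum>k\<in>J. \<integral>x. h x * ln (h x / avg (I - {k}) h x) \<partial>P) +
      (\<integral>x. h x * ln (h x / avg (I - {k}) h x) \<partial>P)"
    using insert h a by (intro add_mono entropy_tensor_step[where a=a and b=b]) auto
  finally show ?case using insert by simp
qed

section \<open>Logarithmic Sobolev inequality for functions of finitely many coordinates\<close>

text \<open>
  The truncated function need not satisfy the hypothesis \<open>ent\<close>, but the entropy of each of its slices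
  is at most that of the corresponding slice of \<open>d\<^sup>2\<close>, and subadditivity is applied after truncation.
\<close>

lemma clamped_entropy_bound:
  assumes J: "finite J" "J \<subseteq> I" and d: "d \<in> L2 P" "determined J d"
    and r: "\<And>k. k \<in> J \<Longrightarrow> r k \<in> L2 P"
    and ent: "\<And>k. k \<in> J \<Longrightarrow> AE x in P. Ent (M k) (\<lambda>t. (d (x(k := t)))\<^sup>2) \<le> ereal (\<integral>t. (r k (x(k := t)))\<^sup>2 \<partial>M k)"
    and ab: "0 < a" "a \<le> b"
  defines "c \<equiv> (\<lambda>x. clamp_on a b \<bar>d x\<bar>)"
  shows "(\<integral>x. (c x)\<^sup>2 \<partial>P) * ln ((\<integral>x. (c x)\<^sup>2 \<partial>P) / (\<integral>x. c x \<partial>P)\<^sup>2) \<le> (\<Sum>k\<in>J. \<integral>x. (r k x)\<^sup>2 \<partial>P)"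
proof -
  have [measurable]: "d \<in> borel_measurable P" and d2: "integrable P (\<lambda>x. (d x)\<^sup>2)"
    using d by (auto simp: L2_def)
  have [measurable]: "c \<in> borel_measurable P" unfolding c_def by measurable
  have cr: "a \<le> c x \<and> c x \<le> b" for x using clamp_on_range ab by (simp add: c_def)
  define h where "h = (\<lambda>x. (c x)\<^sup>2)"
  have hcl: "h x = clamp_on (a\<^sup>2) (b\<^sup>2) ((d x)\<^sup>2)" for x
    using ab by (simp add: h_def c_def clamp_on_square)
  have [measurable]: "h \<in> borel_measurable P" unfolding h_def by measurable
  have ab2: "0 < a\<^sup>2" "a\<^sup>2 \<le> b\<^sup>2" using ab by (auto intro: power_mono)
  have hr: "a\<^sup>2 \<le> h x \<and> h x \<le> b\<^sup>2" for x unfolding hcl by (rule clamp_on_range[OF ab2(2)])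
  have hdet: "determined J h" using d by (auto simp: determined_def hcl)
  have "(\<integral>x. (c x)\<^sup>2 \<partial>P) * ln ((\<integral>x. (c x)\<^sup>2 \<partial>P) / (\<integral>x. c x \<partial>P)\<^sup>2) \<le>
      (\<integral>x. h x * ln (h x / (\<integral>x. h x \<partial>P)) \<partial>P)"
    unfolding h_def using cr ab by (intro P.entropy_square_lower_bound[of c a b]) auto
  also have "\<dots> = (\<integral>x. h x * ln (h x / avg (I - J) h x) \<partial>P)"
    using avg_compl_determined[OF hdet] by (intro Bochner_Integration.integral_cong) auto
  also have "\<dots> \<le> (\<Sum>k\<in>J. \<integral>x. h x * ln (h x / avg (I - {k}) h x) \<partial>P)"
    using hr ab2 by (intro entropy_tensorization[OF J, of h "a\<^sup>2" "b\<^sup>2"]) auto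
  also have "\<dots> \<le> (\<Sum>k\<in>J. \<integral>x. (r k x)\<^sup>2 \<partial>P)"
  proof (rule sum_mono)
    fix k assume kJ: "k \<in> J"
    then have k: "k \<in> I" using J by auto
    let ?e = "\<lambda>x. h x * ln (h x / avg (I - {k}) h x)"
    have ei: "integrable P ?e"
      using avg_range[of h "a\<^sup>2" "b\<^sup>2"] hr ab2 by (intro P.integrable_mult_ln[of h _ _ "a\<^sup>2" "b\<^sup>2"]) auto
    have ri: "integrable P (\<lambda>x. (r k x)\<^sup>2)" using r[OF kJ] by (simp add: L2_def)
    have "(\<integral>x. ?e x \<partial>P) = (\<integral>x. (\<integral>t. ?e (x(k := t)) \<partial>M k) \<partial>P)"
      by (rule upd_integral(3)[OF k ei, symmetric])
    also have "\<dots> \<le> (\<integral>x. (\<integral>t. (r k (x(k := t)))\<^sup>2 \<partial>M k) \<partial>P)"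
    proof (rule integral_mono_AE[OF upd_integral(2)[OF k ei] upd_integral(2)[OF k ri]])
      show "AE x in P. (\<integral>t. ?e (x(k := t)) \<partial>M k) \<le> (\<integral>t. (r k (x(k := t)))\<^sup>2 \<partial>M k)"
        using ent[OF kJ] upd_integral(1)[OF k d2] AE_space
      proof eventually_elim
        case (elim x)
        have [measurable]: "x \<in> space P" by fact
        note [measurable] = k
        have "(\<lambda>t. d (x(k := t))) \<in> L2 (M k)" using elim by (simp add: L2_def)
        from M.clamp_entropy_le[OF this elim(1) ab2]
        have le: "(\<integral>t. h (x(k := t)) * ln (h (x(k := t)) / (\<integral>s. h (x(k := s)) \<partial>M k)) \<partial>M k)
            \<le> (\<integral>t. (r k (x(k := t)))\<^sup>2 \<partial>M k)"
          by (simp add: hcl)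
        \<comment> \<open>the mean of a slice of \<open>h\<close> is the average that occurs in the tensorized entropy\<close>
        have "avg (I - {k}) h (x(k := t)) = (\<integral>s. h (x(k := s)) \<partial>M k)" if "t \<in> space (M k)" for t
          using avg_remove[of k h "x(k := t)"] upd_space[of k x t] k elim that by simp
        then have "(\<integral>t. ?e (x(k := t)) \<partial>M k) =
            (\<integral>t. h (x(k := t)) * ln (h (x(k := t)) / (\<integral>s. h (x(k := s)) \<partial>M k)) \<partial>M k)"
          by (intro Bochner_Integration.integral_cong) auto
        then show ?case using le by simp
      qed
    qed
    also have "\<dots> = (\<integral>x. (r k x)\<^sup>2 \<partial>P)" by (rule upd_integral(3)[OF k ri])
    finally show "(\<integral>x. ?e x \<partial>P) \<le> (\<integral>x. (r k x)\<^sup>2 \<partial>P)" .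
  qed
  finally show ?thesis .
qed

text \<open>
  Only moments of the truncated function occur in the preceding bound, so the truncation can be
  removed by dominated convergence, whether or not \<open>d\<^sup>2 ln d\<^sup>2\<close> is integrable.
\<close>

lemma log_Sobolev_second_moment:
  assumes J: "finite J" "J \<subseteq> I" and d: "d \<in> L2 P" "determined J d"
    and r: "\<And>k. k \<in> J \<Longrightarrow> r k \<in> L2 P"
    and ent: "\<And>k. k \<in> J \<Longrightarrow> AE x in P. Ent (M k) (\<lambda>t. (d (x(k := t)))\<^sup>2) \<le> ereal (\<integral>t. (r k (x(k := t)))\<^sup>2 \<partial>M k)"
  shows "(\<integral>x. (d x)\<^sup>2 \<partial>P) * ln ((\<integral>x. (d x)\<^sup>2 \<partial>P) / (\<integral>x. \<bar>d x\<bar> \<partial>P)\<^sup>2) \<le> (\<Sum>k\<in>J. \<integral>x. (r k x)\<^sup>2 \<partial>P)"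
proof -
  have [measurable]: "d \<in> borel_measurable P" and d2: "integrable P (\<lambda>x. (d x)\<^sup>2)"
    using d by (auto simp: L2_def)
  have d1: "integrable P (\<lambda>x. \<bar>d x\<bar>)" using L2_integrable[OF d(1)] by simp
  define c where "c n x = clamp_on (1 / real (Suc n)) (real (Suc n)) \<bar>d x\<bar>" for n x
  have [measurable]: "c n \<in> borel_measurable P" for n unfolding c_def by measurable
  have ab: "0 < 1 / real (Suc n)" "1 / real (Suc n) \<le> real (Suc n)" for n
    by (auto simp: field_simps)
  have cle: "0 \<le> c n x" "c n x \<le> \<bar>d x\<bar> + 1" for n x
    using ab[of n] by (auto simp: c_def clamp_on_def max_def min_def field_simps)
  have cl: "(\<lambda>n. c n x) \<longlonglongrightarrow> \<bar>d x\<bar>" for x unfolding c_def by (rule clamp_on_tendsto) simp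
  have lim1: "(\<lambda>n. \<integral>x. c n x \<partial>P) \<longlonglongrightarrow> (\<integral>x. \<bar>d x\<bar> \<partial>P)"
    using cle cl d1 by (intro integral_dominated_convergence[where w="\<lambda>x. \<bar>d x\<bar> + 1"]) auto
  have "(\<lambda>n. \<integral>x. (c n x)\<^sup>2 \<partial>P) \<longlonglongrightarrow> (\<integral>x. \<bar>d x\<bar>\<^sup>2 \<partial>P)"
  proof (rule integral_dominated_convergence[where w="\<lambda>x. (\<bar>d x\<bar> + 1)\<^sup>2"])
    show "integrable P (\<lambda>x. (\<bar>d x\<bar> + 1)\<^sup>2)" using d1 d2 by (simp add: power2_sum)
    show "AE x in P. norm ((c n x)\<^sup>2) \<le> (\<bar>d x\<bar> + 1)\<^sup>2" for n
      using cle by (auto intro!: power_mono)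
    show "AE x in P. (\<lambda>n. (c n x)\<^sup>2) \<longlonglongrightarrow> \<bar>d x\<bar>\<^sup>2" by (intro AE_I2 tendsto_power cl)
  qed measurable
  then have lim2: "(\<lambda>n. \<integral>x. (c n x)\<^sup>2 \<partial>P) \<longlonglongrightarrow> (\<integral>x. (d x)\<^sup>2 \<partial>P)" by simp
  let ?B = "\<Sum>k\<in>J. \<integral>x. (r k x)\<^sup>2 \<partial>P"
  show ?thesis
  proof (cases "(\<integral>x. \<bar>d x\<bar> \<partial>P) = 0")
    case True
    then have "AE x in P. \<bar>d x\<bar> = 0" using integral_nonneg_eq_0_iff_AE[OF d1] by simp
    then have "(\<integral>x. (d x)\<^sup>2 \<partial>P) = 0" by (intro integral_eq_zero_AE) simp
    then show ?thesis by (simp add: sum_nonneg)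
  next
    case False
    have "\<not> (AE x in P. (d x)\<^sup>2 = 0)"
    proof
      assume "AE x in P. (d x)\<^sup>2 = 0"
      then have "(\<integral>x. \<bar>d x\<bar> \<partial>P) = 0" by (intro integral_eq_zero_AE) simp
      then show False using False by simp
    qed
    then have ne: "(\<integral>x. (d x)\<^sup>2 \<partial>P) \<noteq> 0" using integral_nonneg_eq_0_iff_AE[OF d2] by simp
    have "(\<lambda>n. (\<integral>x. (c n x)\<^sup>2 \<partial>P) * ln ((\<integral>x. (c n x)\<^sup>2 \<partial>P) / (\<integral>x. c n x \<partial>P)\<^sup>2))
       \<longlonglongrightarrow> (\<integral>x. (d x)\<^sup>2 \<partial>P) * ln ((\<integral>x. (d x)\<^sup>2 \<partial>P) / (\<integral>x. \<bar>d x\<bar> \<partial>P)\<^sup>2)"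
      using False ne by (intro tendsto_intros lim1 lim2) auto
    moreover have "(\<integral>x. (c n x)\<^sup>2 \<partial>P) * ln ((\<integral>x. (c n x)\<^sup>2 \<partial>P) / (\<integral>x. c n x \<partial>P)\<^sup>2) \<le> ?B" for n
      unfolding c_def by (rule clamped_entropy_bound[OF J d r ent ab])
    ultimately show ?thesis by (intro LIMSEQ_le_const2) auto
  qed
qed

section \<open>Approximation by functions of finitely many coordinates\<close>

definition cylinder_approximable :: "(('i \<Rightarrow> 'a) \<Rightarrow> real) \<Rightarrow> bool" where
  "cylinder_approximable f \<longleftrightarrow> f \<in> L2 P \<and>
     (\<forall>e>0. \<exists>J u. finite J \<and> J \<subseteq> I \<and> u \<in> L2 P \<and> determined J u \<and> (\<integral>x. (f x - u x)\<^sup>2 \<partial>P) < e)"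

lemma cylinder_approximable_cong:
  assumes "cylinder_approximable f" "\<And>x. x \<in> space P \<Longrightarrow> f x = g x"
  shows "cylinder_approximable g"
proof -
  have "(\<integral>x. (g x - u x)\<^sup>2 \<partial>P) = (\<integral>x. (f x - u x)\<^sup>2 \<partial>P)" for u
    using assms(2) by (intro Bochner_Integration.integral_cong) auto
  moreover have "g \<in> L2 P \<longleftrightarrow> f \<in> L2 P"
    unfolding L2_def using assms(2)
    by (auto cong: measurable_cong Bochner_Integration.integrable_cong)
  ultimately show ?thesis using assms(1) by (simp add: cylinder_approximable_def)
qed

lemma cylinder_approximable_determined:
  assumes "finite J" "J \<subseteq> I" "determined J u" "u \<in> L2 P"
  shows "cylinder_approximable u"
  unfolding cylinder_approximable_def using assms by (auto intro!: exI[of _ J] exI[of _ u])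

lemma cylinder_approximable_add:
  assumes f: "cylinder_approximable f" and g: "cylinder_approximable g"
  shows "cylinder_approximable (\<lambda>x. f x + g x)"
  unfolding cylinder_approximable_def
proof safe
  show "(\<lambda>x. f x + g x) \<in> L2 P" using f g by (auto simp: cylinder_approximable_def intro: L2_add)
  fix e :: real assume "0 < e"
  then have "0 < e / 4" by simp
  then obtain J u K v where 1: "finite J" "J \<subseteq> I" "u \<in> L2 P" "determined J u" "(\<integral>x. (f x - u x)\<^sup>2 \<partial>P) < e / 4"
    and 2: "finite K" "K \<subseteq> I" "v \<in> L2 P" "determined K v" "(\<integral>x. (g x - v x)\<^sup>2 \<partial>P) < e / 4"
    using f g unfolding cylinder_approximable_def by meson
  have fg: "f \<in> L2 P" "g \<in> L2 P" using f g by (auto simp: cylinder_approximable_def)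
  have "(\<integral>x. (f x + g x - (u x + v x))\<^sup>2 \<partial>P) \<le> (\<integral>x. 2 * (f x - u x)\<^sup>2 + 2 * (g x - v x)\<^sup>2 \<partial>P)"
  proof (rule integral_mono)
    show "integrable P (\<lambda>x. (f x + g x - (u x + v x))\<^sup>2)"
      by (intro L2_dist_integrable L2_add fg 1 2)
    show "(f x + g x - (u x + v x))\<^sup>2 \<le> 2 * (f x - u x)\<^sup>2 + 2 * (g x - v x)\<^sup>2" for x
      using square_add_le[of "f x - u x" "g x - v x"] by (simp add: algebra_simps)
  qed (use L2_dist_integrable[OF fg(1) 1(3)] L2_dist_integrable[OF fg(2) 2(3)] in auto)
  also have "\<dots> < e"
    using L2_dist_integrable[OF fg(1) 1(3)] L2_dist_integrable[OF fg(2) 2(3)] 1(5) 2(5) by simp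
  finally have "(\<integral>x. (f x + g x - (u x + v x))\<^sup>2 \<partial>P) < e" .
  moreover have "determined (J \<union> K) (\<lambda>x. u x + v x)"
    using determined_mono[OF 1(4), of "J \<union> K"] determined_mono[OF 2(4), of "J \<union> K"]
    by (auto simp: determined_def)
  ultimately show "\<exists>J u. finite J \<and> J \<subseteq> I \<and> u \<in> L2 P \<and> determined J u \<and> (\<integral>x. (f x + g x - u x)\<^sup>2 \<partial>P) < e"
    using 1 2 by (intro exI[of _ "J \<union> K"] exI[of _ "\<lambda>x. u x + v x"]) (auto intro: L2_add)
qed

lemma cylinder_approximable_zero: "cylinder_approximable (\<lambda>x. 0)"
  by (rule cylinder_approximable_determined[of "{}"]) (auto simp: determined_def L2_def)

lemma cylinder_approximable_cmult:
  assumes f: "cylinder_approximable f"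
  shows "cylinder_approximable (\<lambda>x. c * f x)"
proof (cases "c = 0")
  case True
  then show ?thesis by (simp add: cylinder_approximable_zero)
next
  case False
  show ?thesis
    unfolding cylinder_approximable_def
  proof safe
    show "(\<lambda>x. c * f x) \<in> L2 P" using f by (auto simp: cylinder_approximable_def intro: L2_cmult)
    fix e :: real assume "0 < e"
    then have "0 < e / c\<^sup>2" using False by simp
    then obtain J u where 1: "finite J" "J \<subseteq> I" "u \<in> L2 P" "determined J u" "(\<integral>x. (f x - u x)\<^sup>2 \<partial>P) < e / c\<^sup>2"
      using f unfolding cylinder_approximable_def by meson
    have "(\<integral>x. (c * f x - c * u x)\<^sup>2 \<partial>P) = c\<^sup>2 * (\<integral>x. (f x - u x)\<^sup>2 \<partial>P)"
      by (simp flip: right_diff_distrib add: power_mult_distrib)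
    also have "\<dots> < e" using 1(5) False by (simp add: field_simps)
    finally show "\<exists>J u. finite J \<and> J \<subseteq> I \<and> u \<in> L2 P \<and> determined J u \<and> (\<integral>x. (c * f x - u x)\<^sup>2 \<partial>P) < e"
      using 1 by (intro exI[of _ J] exI[of _ "\<lambda>x. c * u x"]) (auto intro: L2_cmult simp: determined_def)
  qed
qed

lemma cylinder_approximable_limit:
  assumes f: "f \<in> L2 P" and g: "\<And>n. cylinder_approximable (g n)"
    and le: "\<And>n x. x \<in> space P \<Longrightarrow> \<bar>g n x\<bar> \<le> \<bar>f x\<bar>"
    and lim: "\<And>x. x \<in> space P \<Longrightarrow> (\<lambda>n. g n x) \<longlonglongrightarrow> f x"
  shows "cylinder_approximable f"
  unfolding cylinder_approximable_def
proof safe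
  have gL2: "g n \<in> L2 P" for n using g by (auto simp: cylinder_approximable_def)
  have [measurable]: "f \<in> borel_measurable P" "g n \<in> borel_measurable P" for n
    using f gL2 by (auto simp: L2_def)
  have "(\<lambda>n. \<integral>x. (f x - g n x)\<^sup>2 \<partial>P) \<longlonglongrightarrow> (\<integral>x. 0 \<partial>P)"
  proof (rule integral_dominated_convergence[where w="\<lambda>x. 4 * (f x)\<^sup>2"])
    show "integrable P (\<lambda>x. 4 * (f x)\<^sup>2)" using f by (simp add: L2_def)
    show "AE x in P. (\<lambda>n. (f x - g n x)\<^sup>2) \<longlonglongrightarrow> 0"
    proof (rule AE_I2)
      fix x assume "x \<in> space P"
      then have "(\<lambda>n. (f x - g n x)\<^sup>2) \<longlonglongrightarrow> (f x - f x)\<^sup>2" by (intro tendsto_intros lim)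
      then show "(\<lambda>n. (f x - g n x)\<^sup>2) \<longlonglongrightarrow> 0" by simp
    qed
    show "AE x in P. norm ((f x - g n x)\<^sup>2) \<le> 4 * (f x)\<^sup>2" for n
    proof (rule AE_I2)
      fix x assume "x \<in> space P"
      then have "\<bar>f x - g n x\<bar> \<le> 2 * \<bar>f x\<bar>" using le[of x n] by linarith
      then have "\<bar>f x - g n x\<bar>\<^sup>2 \<le> (2 * \<bar>f x\<bar>)\<^sup>2" by (intro power_mono) auto
      then show "norm ((f x - g n x)\<^sup>2) \<le> 4 * (f x)\<^sup>2" by (simp add: power_mult_distrib)
    qed
  qed measurable
  then have lim0: "(\<lambda>n. \<integral>x. (f x - g n x)\<^sup>2 \<partial>P) \<longlonglongrightarrow> 0" by simp
  fix e :: real assume e: "0 < e"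
  then have "eventually (\<lambda>n. (\<integral>x. (f x - g n x)\<^sup>2 \<partial>P) < e / 4) sequentially"
    using order_tendstoD(2)[OF lim0, of "e / 4"] by simp
  then obtain n where n: "(\<integral>x. (f x - g n x)\<^sup>2 \<partial>P) < e / 4"
    unfolding eventually_sequentially by blast
  have "0 < e / 4" using e by simp
  then obtain J u where 1: "finite J" "J \<subseteq> I" "u \<in> L2 P" "determined J u" "(\<integral>x. (g n x - u x)\<^sup>2 \<partial>P) < e / 4"
    using g[of n] unfolding cylinder_approximable_def by meson
  have i: "integrable P (\<lambda>x. (f x - g n x)\<^sup>2)" "integrable P (\<lambda>x. (g n x - u x)\<^sup>2)"
    by (rule L2_dist_integrable[OF f gL2], rule L2_dist_integrable[OF gL2 1(3)])
  have "(\<integral>x. (f x - u x)\<^sup>2 \<partial>P) \<le> (\<integral>x. 2 * (f x - g n x)\<^sup>2 + 2 * (g n x - u x)\<^sup>2 \<partial>P)"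
  proof (rule integral_mono)
    show "integrable P (\<lambda>x. (f x - u x)\<^sup>2)" by (intro L2_dist_integrable f 1)
    show "(f x - u x)\<^sup>2 \<le> 2 * (f x - g n x)\<^sup>2 + 2 * (g n x - u x)\<^sup>2" for x
      using square_add_le[of "f x - g n x" "g n x - u x"] by simp
  qed (use i in auto)
  also have "\<dots> < e" using i n 1(5) by simp
  finally show "\<exists>J u. finite J \<and> J \<subseteq> I \<and> u \<in> L2 P \<and> determined J u \<and> (\<integral>x. (f x - u x)\<^sup>2 \<partial>P) < e"
    using 1 by (intro exI[of _ J] exI[of _ u]) simp
qed (rule f)

lemma indicator_L2: "A \<in> sets P \<Longrightarrow> indicator A \<in> L2 P"
  unfolding L2_def by (auto intro!: P.integrable_bounded[of _ 1] simp: indicator_def)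

text \<open>
  Cylinders form an intersection-stable generator of the product sigma-algebra, and the class of
  sets with approximable indicator is closed under complements and countable disjoint unions.
\<close>

lemma cylinder_approximable_indicator:
  assumes "A \<in> sets P"
  shows "cylinder_approximable (indicator A)"
proof -
  have sets: "sets P = sigma_sets (\<Pi>\<^sub>E i\<in>I. space (M i)) (prod_algebra I M)" by (rule sets_PiM)
  show ?thesis
    using Int_stable_prod_algebra prod_algebra_sets_into_space assms[unfolded sets]
  proof (induction rule: sigma_sets_induct_disjoint)
    case (basic A)
    then have AP: "A \<in> sets P" unfolding sets by (rule sigma_sets.Basic)
    from basic obtain J E where J: "A = prod_emb I M J (\<Pi>\<^sub>E j\<in>J. E j)" "finite J" "J \<subseteq> I"
      by (elim prod_algebraE) blast
    have "mix J x y \<in> A \<longleftrightarrow> x \<in> A" if "x \<in> space P" "y \<in> space P" for x y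
    proof -
      have "restrict (mix J x y) J = restrict x J" by (auto simp: mix_def fun_eq_iff)
      then show ?thesis
        using that mix_space[OF that, of J] unfolding J(1) prod_emb_def by (simp add: space_PiM)
    qed
    then have "determined J (indicator A)"
      by (auto simp: determined_def indicator_def)
    then show ?case using J AP by (intro cylinder_approximable_determined indicator_L2) auto
  next
    case empty
    show ?case by (rule cylinder_approximable_cong[OF cylinder_approximable_zero]) simp
  next
    case (compl A)
    have "cylinder_approximable (\<lambda>x. 1)"
      by (rule cylinder_approximable_determined[of "{}"]) (auto simp: determined_def L2_def)
    from cylinder_approximable_add[OF this cylinder_approximable_cmult[OF compl(2), of "-1"]]
    have "cylinder_approximable (\<lambda>x. 1 + - 1 * indicator A x)" .
    then show ?case
    proof (rule cylinder_approximable_cong)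
      fix x assume "x \<in> space P"
      then show "1 + - 1 * indicator A x = (indicator ((\<Pi>\<^sub>E i\<in>I. space (M i)) - A) x :: real)"
        by (simp add: space_PiM split: split_indicator)
    qed
  next
    case (union A)
    have A: "A i \<in> sets P" for i using union(2) unfolding sets by blast
    have part: "cylinder_approximable (\<lambda>x. \<Sum>i<n. indicator (A i) x)" for n
    proof (induction n)
      case (Suc n)
      then show ?case using cylinder_approximable_add[OF Suc union(3)[of n]] by simp
    qed (simp add: cylinder_approximable_zero)
    have eq: "(\<Sum>i<n. indicator (A i) x) = (indicator (\<Union>i<n. A i) x :: real)" for n x
      using union(1) by (intro indicator_UN_disjoint[symmetric]) (auto simp: disjoint_family_on_def)
    show ?case
    proof (rule cylinder_approximable_limit)
      show "indicator (\<Union>i. A i) \<in> L2 P" by (intro indicator_L2 sets.countable_UN) (use A in blast)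
      show "cylinder_approximable (\<lambda>x. \<Sum>i<n. indicator (A i) x)" for n by (rule part)
      show "\<bar>\<Sum>i<n. indicator (A i) x\<bar> \<le> \<bar>indicator (\<Union>i. A i) x :: real\<bar>" for n x
        unfolding eq by (auto simp: indicator_def)
      show "(\<lambda>n. \<Sum>i<n. indicator (A i) x) \<longlonglongrightarrow> (indicator (\<Union>i. A i) x :: real)" for x
        unfolding eq by (rule LIMSEQ_indicator_UN)
    qed
  qed
qed

lemma cylinder_approximable_nonneg:
  assumes "f \<in> borel_measurable P" "\<And>x. 0 \<le> f x" "f \<in> L2 P"
  shows "cylinder_approximable f"
  using assms
proof (induction rule: borel_measurable_induct_real)
  case (set A)
  then show ?case by (intro cylinder_approximable_indicator)
next
  case (mult u c)
  show ?case
  proof (cases "c = 0")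
    case True
    then show ?thesis by (simp add: cylinder_approximable_zero)
  next
    case False
    then have "u \<in> L2 P" using L2_cmult[OF mult.prems, of "1 / c"] by simp
    then show ?thesis by (intro cylinder_approximable_cmult mult.IH)
  qed
next
  case (add u v)
  have "\<bar>u x\<bar> \<le> \<bar>v x + u x\<bar>" "\<bar>v x\<bar> \<le> \<bar>v x + u x\<bar>" for x
    using add.hyps(2)[of x] add.hyps(4)[of x] by linarith+
  then have "u \<in> L2 P" "v \<in> L2 P"
    using add.hyps(1,3) by (auto intro: L2_dominated[OF add.prems])
  then show ?case by (intro cylinder_approximable_add add.IH)
next
  case (seq U)
  have le: "\<bar>U n x\<bar> \<le> \<bar>f x\<bar>" if "x \<in> space P" for n x
  proof -
    have "incseq (\<lambda>n. U n x)" using \<open>incseq U\<close> by (auto simp: incseq_def le_fun_def)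
    moreover have "(\<lambda>n. U n x) \<longlonglongrightarrow> f x" using seq that by auto
    ultimately have "U n x \<le> f x" by (rule incseq_le)
    then show ?thesis using seq(2)[of n x] by simp
  qed
  then have "U n \<in> L2 P" for n by (intro L2_dominated[OF seq.prems] seq(1))
  then have "cylinder_approximable (U n)" for n by (rule seq.IH)
  then show ?case using le seq.hyps(4) by (rule cylinder_approximable_limit[OF seq.prems])
qed

text \<open>
  The left-hand side of the inequality is the squared distance of \<open>f\<close> from \<open>avg J f\<close>, which is at most
  its distance from any other function of the coordinates in \<open>J\<close>.
\<close>

lemma cylinder_approximation:
  assumes f: "f \<in> L2 P" and e: "0 < e"
  shows "\<exists>J. finite J \<and> J \<subseteq> I \<and> (\<integral>x. (f x)\<^sup>2 \<partial>P) - (\<integral>x. (avg J f x)\<^sup>2 \<partial>P) < e"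
proof -
  have [measurable]: "f \<in> borel_measurable P" using f by (simp add: L2_def)
  have "cylinder_approximable (\<lambda>x. max (f x) 0)" "cylinder_approximable (\<lambda>x. max (- f x) 0)"
    by (intro cylinder_approximable_nonneg L2_dominated[OF f]; auto)+
  from cylinder_approximable_add[OF this(1) cylinder_approximable_cmult[OF this(2), of "-1"]]
  have "cylinder_approximable f" by (rule cylinder_approximable_cong) auto
  then obtain J u where J: "finite J" "J \<subseteq> I" and u: "u \<in> L2 P" "determined J u"
    and less: "(\<integral>x. (f x - u x)\<^sup>2 \<partial>P) < e"
    using e unfolding cylinder_approximable_def by meson
  have i: "integrable P (\<lambda>x. u x * f x)" by (intro L2_mult u f)
  have aL: "avg J f \<in> L2 P" by (rule avg_L2(1)[OF f])
  have ints: "integrable P (\<lambda>x. (f x)\<^sup>2)" "integrable P (\<lambda>x. (u x)\<^sup>2)" "integrable P (\<lambda>x. (avg J f x)\<^sup>2)"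
    using f u aL by (auto simp: L2_def)
  have "0 \<le> (\<integral>x. (avg J f x - u x)\<^sup>2 \<partial>P)" by simp
  also have "\<dots> = (\<integral>x. (avg J f x)\<^sup>2 + (u x)\<^sup>2 - 2 * (u x * avg J f x) \<partial>P)"
    by (simp add: power2_diff mult_ac)
  also have "\<dots> = (\<integral>x. (avg J f x)\<^sup>2 \<partial>P) + (\<integral>x. (u x)\<^sup>2 \<partial>P) - 2 * (\<integral>x. u x * f x \<partial>P)"
    using ints integral_mult_avg[OF u(2) i] by simp
  finally have "0 \<le> (\<integral>x. (avg J f x)\<^sup>2 \<partial>P) + (\<integral>x. (u x)\<^sup>2 \<partial>P) - 2 * (\<integral>x. u x * f x \<partial>P)" .
  moreover have "(\<integral>x. (u x)\<^sup>2 \<partial>P) - 2 * (\<integral>x. u x * f x \<partial>P) = (\<integral>x. (f x - u x)\<^sup>2 \<partial>P) - (\<integral>x. (f x)\<^sup>2 \<partial>P)"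
  proof -
    have "(\<integral>x. (f x - u x)\<^sup>2 \<partial>P) = (\<integral>x. (f x)\<^sup>2 + (u x)\<^sup>2 - 2 * (u x * f x) \<partial>P)"
      by (simp add: power2_diff mult_ac)
    then show ?thesis using ints i by simp
  qed
  ultimately show ?thesis using less J by (intro exI[of _ J]) auto
qed

end

section \<open>Summation over martingale increments\<close>

lemma log_sum_term:
  fixes a b s :: real
  assumes "0 \<le> a" "0 \<le> b" "b = 0 \<Longrightarrow> a = 0" "0 < s"
  shows "a - b * s \<le> a * ln (a / b) - a * ln s"
proof (cases "a = 0")
  case True
  then show ?thesis using assms by simp
next
  case False
  then have p: "0 < a" "0 < b" using assms by (auto simp: less_le)
  have "a - b * s \<le> a * ln (a / (b * s))" using p assms by (intro mult_ln_ge) auto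
  then show ?thesis using p assms by (simp add: ln_div ln_mult algebra_simps)
qed

lemma log_sum_inequality:
  fixes a b c d :: real
  assumes "0 \<le> a" "0 \<le> b" "b = 0 \<Longrightarrow> a = 0" "0 \<le> c" "0 \<le> d" "d = 0 \<Longrightarrow> c = 0"
  shows "(a + c) * ln ((a + c) / (b + d)) \<le> a * ln (a / b) + c * ln (c / d)"
proof (cases "a + c = 0")
  case True
  then show ?thesis using assms by (simp add: add_nonneg_eq_0_iff)
next
  case False
  then have p: "0 < a + c" "0 < b + d" using assms by (auto simp: add_nonneg_eq_0_iff order.order_iff_strict)
  define s where "s = (a + c) / (b + d)"
  have s: "0 < s" "b * s + d * s = a + c" using p unfolding s_def distrib_right[symmetric] by (auto simp del: distrib_right)
  \<comment> \<open>with this slope \<open>s\<close> the lower bounds for the two terms add up to zero\<close>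
  have "a - b * s + (c - d * s) \<le> (a * ln (a / b) - a * ln s) + (c * ln (c / d) - c * ln s)"
    using assms s by (intro add_mono log_sum_term) auto
  then show ?thesis using s(2) by (simp add: s_def[symmetric] algebra_simps)
qed

lemma mult_ln_divide_mono:
  fixes a b c :: real
  assumes "0 \<le> a" "0 \<le> b" "b = 0 \<Longrightarrow> a = 0" "b \<le> c"
  shows "a * ln (a / c) \<le> a * ln (a / b)"
proof (cases "a = 0")
  case False
  then have "0 < a" "0 < b" using assms by (auto simp: less_le)
  moreover from this have "0 < c" using assms by simp
  ultimately show ?thesis using assms by (intro mult_left_mono) (auto simp: frac_le)
qed simp

context product_prob_space
begin

lemma Delta_eq:
  assumes "k \<in> I" "f \<in> borel_measurable P" "x \<in> space P"
  shows "Delta M k f x = f x - avg (I - {k}) f x"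
  using avg_remove[OF assms] by (simp add: Delta_def)

text \<open>
  The increment is \<open>avg (insert j J)\<close> of \<open>Delta M j f\<close>, and \<open>avg\<close> is a contraction in the \<open>L\<^sup>1\<close> norm.
\<close>

lemma norm1_increment_le:
  assumes f: "integrable P f" and j: "j \<in> I" "j \<notin> J" and JI: "J \<subseteq> I"
  shows "(\<integral>x. \<bar>avg (insert j J) f x - avg J f x\<bar> \<partial>P) \<le> norm1 P (Delta M j f)"
proof -
  have [measurable]: "f \<in> borel_measurable P" using f by auto
  let ?D = "\<lambda>x. f x - avg (I - {j}) f x"
  have Di: "integrable P ?D" using f mix_integral(2)[OF f] by simp
  have ai: "integrable P (avg (I - {j}) f)" by (rule mix_integral(2)[OF f])
  \<comment> \<open>averaging over coordinate \<open>j\<close> and then over those outside \<open>insert j J\<close> amounts to \<open>avg J\<close>\<close>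
  have "(I - {j}) \<inter> insert j J = J" using j JI by auto
  then have "AE x in P. avg (insert j J) (avg (I - {j}) f) x = avg J f x"
    using avg_avg[OF f, of "insert j J" "I - {j}"] by simp
  then have "AE x in P. avg (insert j J) f x - avg J f x = avg (insert j J) ?D x"
    using mix_integral(1)[OF f, of "insert j J"] mix_integral(1)[OF ai, of "insert j J"]
  proof eventually_elim
    case (elim x)
    then show ?case by (simp add: avg_def)
  qed
  then have "(\<integral>x. \<bar>avg (insert j J) f x - avg J f x\<bar> \<partial>P) = (\<integral>x. \<bar>avg (insert j J) ?D x\<bar> \<partial>P)"
    by (intro integral_cong_AE) (measurable, auto)
  also have "\<dots> \<le> (\<integral>x. \<bar>?D x\<bar> \<partial>P)" by (rule avg_abs_le[OF Di])
  also have "\<dots> = norm1 P (Delta M j f)"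
    unfolding norm1_def using Delta_eq[OF j(1)] by (intro Bochner_Integration.integral_cong) auto
  finally show ?thesis .
qed

definition increment :: "'i \<Rightarrow> 'i set \<Rightarrow> (('i \<Rightarrow> 'a) \<Rightarrow> real) \<Rightarrow> ('i \<Rightarrow> 'a) \<Rightarrow> real" where
  "increment j J f x = avg (insert j J) f x - avg J f x"

text \<open>
  The right-hand side is written as a difference so that it telescopes when coordinates are added
  successively: the squared norms of the increments of \<open>g k\<close> are differences by orthogonality.
\<close>

lemma increment_log_bound:
  assumes f: "f \<in> L2 P" and g: "\<And>k. k \<in> I \<Longrightarrow> g k \<in> L2 P"
    and J: "finite J" "J \<subseteq> I" and j: "j \<in> I" "j \<notin> J"
    and ent_new: "AE x in P. Ent (M j) (\<lambda>t. (increment j J f (x(j := t)))\<^sup>2)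
        \<le> ereal (\<integral>t. (avg (insert j J) (g j) (x(j := t)))\<^sup>2 \<partial>M j)"
    and ent_old: "\<And>k. k \<in> J \<Longrightarrow> AE x in P. Ent (M k) (\<lambda>t. (increment j J f (x(k := t)))\<^sup>2)
        \<le> ereal (\<integral>t. (increment j J (g k) (x(k := t)))\<^sup>2 \<partial>M k)"
  defines "D \<equiv> (\<integral>x. (avg (insert j J) f x)\<^sup>2 \<partial>P) - (\<integral>x. (avg J f x)\<^sup>2 \<partial>P)"
    and "b \<equiv> (norm1 P (Delta M j f))\<^sup>2"
  shows "0 \<le> D" and "b = 0 \<Longrightarrow> D = 0"
    and "D * ln (D / b) \<le> (\<Sum>k\<in>insert j J. \<integral>x. (avg (insert j J) (g k) x)\<^sup>2 \<partial>P) - (\<Sum>k\<in>J. \<integral>x. (avg J (g k) x)\<^sup>2 \<partial>P)"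
proof -
  let ?d = "increment j J f"
  have sub: "J \<subseteq> insert j J" by auto
  have dL: "?d \<in> L2 P" unfolding increment_def by (intro L2_diff avg_L2 f)
  have ddet: "determined (insert j J) ?d"
    using determined_avg[OF sub, of f] determined_avg[of "insert j J" "insert j J" f]
    by (auto simp: determined_def increment_def)
  have D: "D = (\<integral>x. (?d x)\<^sup>2 \<partial>P)" unfolding D_def increment_def by (rule avg_pythagoras[OF f sub, symmetric])
  then show D0: "0 \<le> D" by simp
  have n1: "(\<integral>x. \<bar>?d x\<bar> \<partial>P) \<le> norm1 P (Delta M j f)"
    unfolding increment_def by (rule norm1_increment_le[OF L2_integrable[OF f] j J(2)])
  have n0: "0 \<le> (\<integral>x. \<bar>?d x\<bar> \<partial>P)" by simp
  have d1: "integrable P (\<lambda>x. \<bar>?d x\<bar>)" using L2_integrable[OF dL] by simp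
  have zero: "D = 0" if "(\<integral>x. \<bar>?d x\<bar> \<partial>P)\<^sup>2 = 0"
  proof -
    have "AE x in P. \<bar>?d x\<bar> = 0" using integral_nonneg_eq_0_iff_AE[OF d1] that by simp
    then show ?thesis unfolding D by (intro integral_eq_zero_AE) simp
  qed
  have le: "(\<integral>x. \<bar>?d x\<bar> \<partial>P)\<^sup>2 \<le> b" unfolding b_def using n0 n1 by (intro power_mono)
  show "D = 0" if "b = 0" using zero le that by simp
  \<comment> \<open>the image of the increment under the operator in coordinate \<open>k\<close>: the newly revealed coordinate \<open>j\<close> contributes no \<open>avg J\<close> part\<close>
  define r where "r k = (if k = j then avg (insert j J) (g j) else increment j J (g k))" for k
  have "D * ln (D / b) \<le> D * ln (D / (\<integral>x. \<bar>?d x\<bar> \<partial>P)\<^sup>2)"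
    using D0 zero le by (intro mult_ln_divide_mono) auto
  also have "\<dots> \<le> (\<Sum>k\<in>insert j J. \<integral>x. (r k x)\<^sup>2 \<partial>P)"
    unfolding D
  proof (rule log_Sobolev_second_moment[OF _ _ dL ddet])
    fix k assume k: "k \<in> insert j J"
    then have kI: "k \<in> I" using j J by auto
    show "r k \<in> L2 P"
      using avg_L2(1)[OF g[OF kI]] L2_diff[OF avg_L2(1)[OF g[OF kI]] avg_L2(1)[OF g[OF kI]], of "insert j J" J]
      by (auto simp: r_def increment_def[abs_def])
    show "AE x in P. Ent (M k) (\<lambda>t. (?d (x(k := t)))\<^sup>2) \<le> ereal (\<integral>t. (r k (x(k := t)))\<^sup>2 \<partial>M k)"
    proof (cases "k = j")
      case True
      then show ?thesis using ent_new by (simp add: r_def)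
    next
      case False
      then show ?thesis using ent_old[of k] k by (simp add: r_def)
    qed
  qed (use J j in auto)
  also have "\<dots> = (\<integral>x. (avg (insert j J) (g j) x)\<^sup>2 \<partial>P) + (\<Sum>k\<in>J. \<integral>x. (increment j J (g k) x)\<^sup>2 \<partial>P)"
    using J j by (subst sum.insert) (auto simp: r_def intro!: sum.cong)
  also have "(\<Sum>k\<in>J. \<integral>x. (increment j J (g k) x)\<^sup>2 \<partial>P) =
      (\<Sum>k\<in>J. (\<integral>x. (avg (insert j J) (g k) x)\<^sup>2 \<partial>P) - (\<integral>x. (avg J (g k) x)\<^sup>2 \<partial>P))"
    unfolding increment_def using J g by (intro sum.cong avg_pythagoras sub) auto
  finally show "D * ln (D / b) \<le> (\<Sum>k\<in>insert j J. \<integral>x. (avg (insert j J) (g k) x)\<^sup>2 \<partial>P) - (\<Sum>k\<in>J. \<integral>x. (avg J (g k) x)\<^sup>2 \<partial>P)"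
    using J j by (simp add: sum_subtractf)
qed

text \<open>
  By induction on \<open>J\<close>, adding the increment bounds with the log-sum inequality. As \<open>x / 0 = 0\<close>, that
  inequality needs the numerators to vanish together with the denominators, which is why the middle
  conjunct is carried along.
\<close>

lemma finite_log_bound:
  assumes f: "f \<in> L2 P" and g: "\<And>k. k \<in> I \<Longrightarrow> g k \<in> L2 P"
    and ent_new: "\<And>J j. finite J \<Longrightarrow> J \<subseteq> I \<Longrightarrow> j \<in> I \<Longrightarrow> j \<notin> J \<Longrightarrow>
      AE x in P. Ent (M j) (\<lambda>t. (increment j J f (x(j := t)))\<^sup>2)
        \<le> ereal (\<integral>t. (avg (insert j J) (g j) (x(j := t)))\<^sup>2 \<partial>M j)"
    and ent_old: "\<And>J j k. finite J \<Longrightarrow> J \<subseteq> I \<Longrightarrow> j \<in> I \<Longrightarrow> j \<notin> J \<Longrightarrow> k \<in> J \<Longrightarrow>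
      AE x in P. Ent (M k) (\<lambda>t. (increment j J f (x(k := t)))\<^sup>2)
        \<le> ereal (\<integral>t. (increment j J (g k) (x(k := t)))\<^sup>2 \<partial>M k)"
    and J: "finite J" "J \<subseteq> I"
  defines "V \<equiv> \<lambda>J. (\<integral>x. (avg J f x)\<^sup>2 \<partial>P) - (\<integral>x. f x \<partial>P)\<^sup>2"
    and "S \<equiv> \<lambda>J. \<Sum>j\<in>J. (norm1 P (Delta M j f))\<^sup>2"
  shows "0 \<le> V J \<and> (S J = 0 \<longrightarrow> V J = 0) \<and>
    V J * ln (V J / S J) \<le> (\<Sum>k\<in>J. \<integral>x. (avg J (g k) x)\<^sup>2 \<partial>P)"
  using J
proof (induction J)
  case empty
  have "avg {} f x = (\<integral>x. f x \<partial>P)" for x by (simp add: avg_def mix_def)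
  then have "V {} = 0" by (simp add: V_def P.prob_space)
  then show ?case by simp
next
  case (insert j J)
  then have J: "finite J" "J \<subseteq> I" and j: "j \<in> I" "j \<notin> J" by auto
  let ?D = "(\<integral>x. (avg (insert j J) f x)\<^sup>2 \<partial>P) - (\<integral>x. (avg J f x)\<^sup>2 \<partial>P)"
  let ?b = "(norm1 P (Delta M j f))\<^sup>2"
  note bnd = increment_log_bound[OF f g J j ent_new[OF J j] ent_old[OF J j]]
  have inc: "0 \<le> ?D" "?b = 0 \<Longrightarrow> ?D = 0"
    "?D * ln (?D / ?b) \<le> (\<Sum>k\<in>insert j J. \<integral>x. (avg (insert j J) (g k) x)\<^sup>2 \<partial>P) - (\<Sum>k\<in>J. \<integral>x. (avg J (g k) x)\<^sup>2 \<partial>P)"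
    by (rule bnd; assumption)+
  have V: "V (insert j J) = V J + ?D" by (simp add: V_def)
  have S: "S (insert j J) = S J + ?b" using J j by (simp add: S_def)
  have S0: "0 \<le> S J" by (simp add: S_def sum_nonneg)
  have IH: "0 \<le> V J" "S J = 0 \<Longrightarrow> V J = 0" "V J * ln (V J / S J) \<le> (\<Sum>k\<in>J. \<integral>x. (avg J (g k) x)\<^sup>2 \<partial>P)"
    using insert.IH[OF J(2)] by blast+
  have "(V J + ?D) * ln ((V J + ?D) / (S J + ?b)) \<le> V J * ln (V J / S J) + ?D * ln (?D / ?b)"
    by (rule log_sum_inequality[OF IH(1) S0 IH(2) inc(1) zero_le_power2 inc(2)])
  also have "\<dots> \<le> (\<Sum>k\<in>insert j J. \<integral>x. (avg (insert j J) (g k) x)\<^sup>2 \<partial>P)"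
    using IH(3) inc(3) by linarith
  finally have bound: "(V J + ?D) * ln ((V J + ?D) / (S J + ?b)) \<le>
      (\<Sum>k\<in>insert j J. \<integral>x. (avg (insert j J) (g k) x)\<^sup>2 \<partial>P)" .
  have "0 \<le> V J + ?D" using IH(1) inc(1) by linarith
  moreover have "V J + ?D = 0" if "S J + ?b = 0"
  proof -
    have "S J = 0" "?b = 0" using that S0 zero_le_power2[of "norm1 P (Delta M j f)"] by linarith+
    then show ?thesis using IH(2) inc(2) by linarith
  qed
  ultimately show ?case unfolding V S using bound by blast
qed

text \<open>
  The bound for finite \<open>J\<close> weakens when \<open>S\<close> and \<open>B\<close> grow, so it holds with \<open>S\<close> and \<open>B\<close> uniform in
  \<open>J\<close>, and the variance of \<open>avg J f\<close> comes arbitrarily close to that of \<open>f\<close>.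
\<close>

lemma variance_log_bound:
  assumes f: "f \<in> L2 P" and g: "\<And>k. k \<in> I \<Longrightarrow> g k \<in> L2 P"
    and ent_new: "\<And>J j. finite J \<Longrightarrow> J \<subseteq> I \<Longrightarrow> j \<in> I \<Longrightarrow> j \<notin> J \<Longrightarrow>
      AE x in P. Ent (M j) (\<lambda>t. (increment j J f (x(j := t)))\<^sup>2)
        \<le> ereal (\<integral>t. (avg (insert j J) (g j) (x(j := t)))\<^sup>2 \<partial>M j)"
    and ent_old: "\<And>J j k. finite J \<Longrightarrow> J \<subseteq> I \<Longrightarrow> j \<in> I \<Longrightarrow> j \<notin> J \<Longrightarrow> k \<in> J \<Longrightarrow>
      AE x in P. Ent (M k) (\<lambda>t. (increment j J f (x(k := t)))\<^sup>2)
        \<le> ereal (\<integral>t. (increment j J (g k) (x(k := t)))\<^sup>2 \<partial>M k)"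
    and S: "\<And>J. finite J \<Longrightarrow> J \<subseteq> I \<Longrightarrow> (\<Sum>j\<in>J. (norm1 P (Delta M j f))\<^sup>2) \<le> S"
    and B: "\<And>J. finite J \<Longrightarrow> J \<subseteq> I \<Longrightarrow> (\<Sum>k\<in>J. \<integral>x. (g k x)\<^sup>2 \<partial>P) \<le> B"
  shows "S = 0 \<Longrightarrow> P.variance f = 0" and "P.variance f * ln (P.variance f / S) \<le> B"
proof -
  define V where "V J = (\<integral>x. (avg J f x)\<^sup>2 \<partial>P) - (\<integral>x. f x \<partial>P)\<^sup>2" for J
  define v where "v = P.variance f"
  define s where "s J = (\<Sum>j\<in>J. (norm1 P (Delta M j f))\<^sup>2)" for J
  have s0: "0 \<le> s J" for J unfolding s_def by (simp add: sum_nonneg)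
  have v: "v = (\<integral>x. (f x)\<^sup>2 \<partial>P) - (\<integral>x. f x \<partial>P)\<^sup>2"
    unfolding v_def using f L2_integrable[OF f] by (intro P.variance_eq) (auto simp: L2_def)
  have fin: "S = 0 \<longrightarrow> V J = 0" "V J * ln (V J / S) \<le> B"
    if J: "finite J" "J \<subseteq> I" for J
  proof -
    have fl: "0 \<le> V J \<and> (s J = 0 \<longrightarrow> V J = 0) \<and>
        V J * ln (V J / s J) \<le> (\<Sum>k\<in>J. \<integral>x. (avg J (g k) x)\<^sup>2 \<partial>P)"
      unfolding V_def s_def by (rule finite_log_bound[OF f g ent_new ent_old J]; assumption)
    have sS: "s J \<le> S" unfolding s_def by (rule S[OF J])
    have "V J * ln (V J / S) \<le> V J * ln (V J / s J)"
      using fl sS s0 by (intro mult_ln_divide_mono) blast+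
    also have "\<dots> \<le> (\<Sum>k\<in>J. \<integral>x. (avg J (g k) x)\<^sup>2 \<partial>P)" using fl by blast
    also have "\<dots> \<le> (\<Sum>k\<in>J. \<integral>x. (g k x)\<^sup>2 \<partial>P)"
      using J g by (intro sum_mono avg_L2(2)) blast
    also have "\<dots> \<le> B" by (rule B[OF J])
    finally show "V J * ln (V J / S) \<le> B" .
    show "S = 0 \<longrightarrow> V J = 0" using sS s0[of J] fl by linarith
  qed
  have "\<exists>J. finite J \<and> J \<subseteq> I \<and> v - V J < 1 / real (Suc n)" for n
    using cylinder_approximation[OF f, of "1 / real (Suc n)"] by (simp add: v V_def)
  then obtain J where J: "\<And>n. finite (J n)" "\<And>n. J n \<subseteq> I" "\<And>n. v - V (J n) < 1 / real (Suc n)"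
    by metis
  have le: "V (J n) \<le> v" for n using avg_L2(2)[OF f] by (simp add: v V_def)
  have lim: "(\<lambda>n. V (J n)) \<longlonglongrightarrow> v"
  proof (rule tendsto_sandwich)
    show "\<forall>\<^sub>F n in sequentially. v - 1 / real (Suc n) \<le> V (J n)"
    proof (intro always_eventually allI)
      show "v - 1 / real (Suc n) \<le> V (J n)" for n using J(3)[of n] by linarith
    qed
    show "\<forall>\<^sub>F n in sequentially. V (J n) \<le> v" using le by simp
    have "(\<lambda>n. v - 1 / real (Suc n)) \<longlonglongrightarrow> v - 0"
      by (intro tendsto_diff tendsto_const LIMSEQ_Suc lim_1_over_n)
    then show "(\<lambda>n. v - 1 / real (Suc n)) \<longlonglongrightarrow> v" by simp
    show "(\<lambda>n. v) \<longlonglongrightarrow> v" by simp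
  qed
  have z: "v = 0" if "S = 0"
  proof -
    have "V (J n) = 0" for n using fin(1)[OF J(1,2)[of n]] that by blast
    then have "(\<lambda>n. 0) \<longlonglongrightarrow> v" using lim by simp
    from LIMSEQ_unique[OF this tendsto_const] show ?thesis .
  qed
  then show "P.variance f = 0" if "S = 0" using that unfolding v_def .
  have B0: "0 \<le> B" using B[of "{}"] by simp
  have "v * ln (v / S) \<le> B"
  proof (cases "v = 0")
    case False
    then have S: "S \<noteq> 0" using z by blast
    then have "(\<lambda>n. V (J n) * ln (V (J n) / S)) \<longlonglongrightarrow> v * ln (v / S)"
      using False by (intro tendsto_mult[OF lim] tendsto_ln tendsto_divide[OF lim] tendsto_const) auto
    then show ?thesis using fin(2)[OF J(1,2)] by (intro LIMSEQ_le_const2) auto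
  qed (use B0 in simp)
  then show "P.variance f * ln (P.variance f / S) \<le> B" unfolding v_def .
qed

section \<open>Slices and operators in one coordinate\<close>

lemma distr_restrict_others:
  "distr P (PiM (I - {j}) M) (\<lambda>x. restrict x (I - {j})) = PiM (I - {j}) M"
  using distr_PiM_reindex[of I M "\<lambda>i. i" "I - {j}"] M.prob_space_axioms by auto

lemma measurable_restrict_others [measurable]:
  "(\<lambda>x. restrict x (I - {j})) \<in> measurable P (PiM (I - {j}) M)"
  by (intro measurable_restrict_subset) auto

lemma AE_others_iff:
  assumes j: "j \<in> I"
  shows "(AE y in PiM (I - {j}) M. Q y) \<longleftrightarrow> (AE x in P. Q (restrict x (I - {j})))"
proof
  assume "AE y in PiM (I - {j}) M. Q y"
  then show "AE x in P. Q (restrict x (I - {j}))"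
    by (rule AE_distr_eq[OF distr_restrict_others measurable_restrict_others])
next
  assume Q: "AE x in P. Q (restrict x (I - {j}))"
  let ?N = "PiM (I - {j}) M"
  interpret N: product_prob_space M "I - {j}" by unfold_locales
  interpret MN: pair_prob_space "M j" ?N by unfold_locales
  have ins: "insert j (I - {j}) = I" using j by auto
  have d: "distr (M j \<Otimes>\<^sub>M ?N) P (\<lambda>(t, y). y(j := t)) = P"
    using distr_pair_PiM_eq_PiM[of "I - {j}" M j] M.prob_space_axioms ins by simp
  have m: "(\<lambda>(t, y). y(j := t)) \<in> measurable (M j \<Otimes>\<^sub>M ?N) P"
    using measurable_compose[OF measurable_pair_swap' measurable_add_dim[of j "I - {j}" M]] ins
    by (simp add: split_beta')
  \<comment> \<open>as \<open>Q\<close> need not be measurable, this direction goes through a map onto \<open>P\<close> that keeps \<open>y\<close> intact\<close>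
  have "AE t in M j. AE y in ?N. Q (restrict (y(j := t)) (I - {j}))"
    using MN.AE_pair[OF AE_distr_eq[OF d m Q]] by simp
  then have "AE t in M j. AE y in ?N. Q y"
  proof eventually_elim
    case (elim t)
    then show ?case using AE_space
    proof eventually_elim
      case (elim y)
      have "restrict (y(j := t)) (I - {j}) = y"
        using elim(2) by (auto simp: space_PiM PiE_iff extensional_def fun_eq_iff)
      then show ?case using elim by simp
    qed
  qed
  then show "AE y in ?N. Q y" by simp
qed

lemma restrict_upd: "j \<in> I \<Longrightarrow> x \<in> space P \<Longrightarrow> (restrict x (I - {j}))(j := t) = x(j := t)"
  by (auto simp: space_PiM PiE_iff extensional_def fun_eq_iff)

lemma slice_restrict: "j \<in> I \<Longrightarrow> x \<in> space P \<Longrightarrow> slice j f (restrict x (I - {j})) = slice j f x"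
  unfolding slice_def by (simp only: restrict_upd)

lemma AE_slice_iff:
  assumes j: "j \<in> I"
  shows "(AE y in PiM (I - {j}) M. slice j f y \<in> B) \<longleftrightarrow> (AE x in P. slice j f x \<in> B)"
  unfolding AE_others_iff[OF j] using slice_restrict[OF j] by (intro AE_cong) auto

lemma product_class_iff:
  "f \<in> product_class I M A \<longleftrightarrow> f \<in> L2 P \<and> (\<forall>j\<in>I. AE x in P. slice j f x \<in> A j)"
  by (auto simp: product_class_def AE_slice_iff)

lemma coordinate_extensionD:
  assumes "coordinate_extension I M A j R T" "f \<in> product_class I M A" and j: "j \<in> I"
  shows "T f \<in> borel_measurable P"
    and "AE x in P. AE t in M j. T f (x(j := t)) = R (slice j f x) t"
proof -
  show "T f \<in> borel_measurable P" using assms by (auto simp: coordinate_extension_def)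
  have "AE y in PiM (I - {j}) M. AE t in M j. T f (y(j := t)) = R (slice j f y) t"
    using assms by (auto simp: coordinate_extension_def)
  then have "AE x in P. AE t in M j. T f ((restrict x (I - {j}))(j := t)) = R (slice j f (restrict x (I - {j}))) t"
    unfolding AE_others_iff[OF j] .
  then show "AE x in P. AE t in M j. T f (x(j := t)) = R (slice j f x) t"
    using AE_space by eventually_elim (simp only: restrict_upd[OF j] slice_restrict[OF j])
qed

lemma integral_others:
  fixes f :: "('i \<Rightarrow> 'a) \<Rightarrow> real"
  assumes k: "k \<in> I" and t: "t \<in> space (M k)" and f: "f \<in> borel_measurable P"
  shows "(\<integral>y. f (y(k := t)) \<partial>PiM (I - {k}) M) = (\<integral>z. f (z(k := t)) \<partial>P)"
proof -
  have ins: "insert k (I - {k}) = I" using k by auto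
  have "(\<lambda>y. (y, t)) \<in> measurable (PiM (I - {k}) M) (PiM (I - {k}) M \<Otimes>\<^sub>M M k)"
    using t by measurable
  from measurable_compose[OF this measurable_add_dim]
  have m: "(\<lambda>y. y(k := t)) \<in> measurable (PiM (I - {k}) M) P"
    unfolding ins by simp
  have "(\<integral>y. f (y(k := t)) \<partial>PiM (I - {k}) M) = (\<integral>z. f ((restrict z (I - {k}))(k := t)) \<partial>P)"
    by (rule integral_distr_eq(1)[where f="\<lambda>y. f (y(k := t))",
          OF distr_restrict_others measurable_restrict_others measurable_compose[OF m f], symmetric])
  also have "\<dots> = (\<integral>z. f (z(k := t)) \<partial>P)"
    by (intro Bochner_Integration.integral_cong refl) (simp only: restrict_upd[OF k])
  finally show ?thesis .
qed

text \<open>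
  A frozen coordinate makes the slices constant, and constants belong to every \<open>A j\<close>; slices in the
  other coordinates are slices of \<open>f\<close> itself. Countability of \<open>I\<close> allows one null set for all
  coordinates.
\<close>

lemma frozen_in_product_class:
  assumes I: "countable I" and f: "f \<in> product_class I M A"
    and const: "\<And>j c. j \<in> I \<Longrightarrow> (\<lambda>t. c) \<in> A j"
  shows "AE x in P. (\<lambda>z. f (mix K x z)) \<in> product_class I M A"
proof -
  have fL: "f \<in> L2 P" and sl: "\<And>j. j \<in> I \<Longrightarrow> AE x in P. slice j f x \<in> A j"
    using f by (auto simp: product_class_iff)
  have [measurable]: "f \<in> borel_measurable P" using fL by (simp add: L2_def)
  have f2: "integrable P (\<lambda>x. (f x)\<^sup>2)" using fL by (simp add: L2_def)
  have "AE x in P. \<forall>j\<in>I. AE z in P. slice j (\<lambda>z. f (mix K x z)) z \<in> A j"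
    unfolding AE_ball_countable[OF I]
  proof
    fix j assume j: "j \<in> I"
    show "AE x in P. AE z in P. slice j (\<lambda>z. f (mix K x z)) z \<in> A j"
    proof (cases "j \<in> K")
      case True
      then show ?thesis using const[OF j] by (simp add: slice_def mix_upd_absorb)
    next
      case False
      then show ?thesis using AE_mix[OF sl[OF j], of K] by (simp add: slice_def mix_upd_outside)
    qed
  qed
  then show ?thesis using mix_integral(1)[OF f2, of K] AE_space
  proof eventually_elim
    case (elim x)
    have [measurable]: "x \<in> space P" by (rule elim)
    have "(\<lambda>z. f (mix K x z)) \<in> L2 P" using elim(2) by (simp add: L2_def)
    then show ?case using elim(1) by (simp add: product_class_iff)
  qed
qed

text \<open>
  With the coordinates in \<open>J - {k}\<close> frozen at \<open>x\<close>, the integral of \<open>f\<close> over all coordinates but \<open>k\<close> is the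
  slice of \<open>avg J f\<close> at \<open>x\<close>, so the commutation hypothesis applies to the frozen function. Its
  image under \<open>RI k\<close> is the frozen image of \<open>f\<close>, since both are given by the same slices.
\<close>

lemma operator_avg:
  assumes I: "countable I"
    and sub: "\<And>i. i \<in> I \<Longrightarrow> L2_subspace (M i) (A i)"
    and const: "\<And>j c. j \<in> I \<Longrightarrow> (\<lambda>t. c) \<in> A j"
    and lin: "\<And>i. i \<in> I \<Longrightarrow> L2_linear_operator (M i) (A i) (R i)"
    and ext: "\<And>i. i \<in> I \<Longrightarrow> coordinate_extension I M A i (R i) (RI i)"
    and marg: "\<And>i f. i \<in> I \<Longrightarrow> f \<in> product_class I M A \<Longrightarrow> integrate_others I M i f \<in> A i"
    and comm: "\<And>i f. i \<in> I \<Longrightarrow> f \<in> product_class I M A \<Longrightarrow> AE t in M i.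
         has_bochner_integral (PiM (I - {i}) M) (\<lambda>y. RI i f (y(i := t))) (R i (integrate_others I M i f) t)"
    and f: "f \<in> product_class I M A" and J: "J \<subseteq> I" and k: "k \<in> J"
  shows "AE x in P. slice k (avg J f) x \<in> A k \<and>
    (AE t in M k. R k (slice k (avg J f) x) t = avg J (RI k f) (x(k := t)))"
proof -
  have kI: "k \<in> I" using k J by auto
  interpret Pk: pair_prob_space P "M k" by unfold_locales
  have fL: "f \<in> L2 P" using f by (simp add: product_class_iff)
  have [measurable]: "f \<in> borel_measurable P" using fL by (simp add: L2_def)
  have aL: "integrable P (\<lambda>x. (avg J f x)\<^sup>2)" using avg_L2(1)[OF fL] by (simp add: L2_def)
  have [measurable]: "RI k f \<in> borel_measurable P" by (rule coordinate_extensionD(1)[OF ext[OF kI] f kI])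
  let ?K = "J - {k}"
  let ?G = "\<lambda>x z. f (mix ?K x z)"
  have kK: "k \<notin> ?K" by simp
  have "AE x in P. AE z in P. AE t in M k. RI k f (mix ?K x (z(k := t))) = R k (slice k (?G x) z) t"
    using AE_mix[OF coordinate_extensionD(2)[OF ext[OF kI] f kI], of ?K]
    by (simp add: mix_upd_outside[OF kK] slice_def)
  moreover have "AE x in P. ?G x \<in> product_class I M A"
    by (rule frozen_in_product_class[OF I f]) (rule const)
  ultimately show ?thesis
    using upd_integral(1)[OF kI aL] AE_space
  proof eventually_elim
    case (elim x)
    have G: "?G x \<in> product_class I M A" using elim(2) by blast
    have [measurable]: "x \<in> space P" by (rule elim)
    note [measurable] = kI
    have [measurable]: "RI k (?G x) \<in> borel_measurable P"
      by (rule coordinate_extensionD(1)[OF ext[OF kI] G kI])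
    have marg_eq: "integrate_others I M k (?G x) t = slice k (avg J f) x t" if "t \<in> space (M k)" for t
    proof -
      have "integrate_others I M k (?G x) t = (\<integral>z. ?G x (z(k := t)) \<partial>P)"
        unfolding integrate_others_def by (rule integral_others[OF kI that]) measurable
      then show ?thesis by (simp add: slice_def avg_def mix_upd_inside[OF k])
    qed
    \<comment> \<open>\<open>integrate_others\<close> and the slice agree only on \<open>space (M k)\<close>; saturation of \<open>A k\<close> transfers membership\<close>
    have sL: "slice k (avg J f) x \<in> L2 (M k)"
      using elim(3) by (simp add: L2_def slice_def)
    have mA: "integrate_others I M k (?G x) \<in> A k" by (rule marg[OF kI G])
    have AEeq: "AE t in M k. integrate_others I M k (?G x) t = slice k (avg J f) x t"
      using marg_eq by (intro AE_I2)
    then have sA: "slice k (avg J f) x \<in> A k"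
      using sub[OF kI] mA sL unfolding L2_subspace_def by blast
    have Req: "AE t in M k. R k (integrate_others I M k (?G x)) t = R k (slice k (avg J f) x) t"
      using lin[OF kI] mA sA AEeq unfolding L2_linear_operator_def by blast
    have "AE z in P. AE t in M k. RI k (?G x) (z(k := t)) = RI k f (mix ?K x (z(k := t)))"
      using elim(1) coordinate_extensionD(2)[OF ext[OF kI] G kI]
    proof eventually_elim
      case (elim z)
      then show ?case by eventually_elim simp
    qed
    \<comment> \<open>the hypothesis on \<open>R k\<close> is for almost every \<open>t\<close>, so the order of the null sets has to be exchanged\<close>
    then have swap: "AE t in M k. AE z in P. RI k (?G x) (z(k := t)) = RI k f (mix ?K x (z(k := t)))"
      by (subst (asm) Pk.AE_commute) measurable
    have "AE t in M k. R k (slice k (avg J f) x) t = avg J (RI k f) (x(k := t))"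
      using swap comm[OF kI G] Req AE_space
    proof eventually_elim
      case (elim t)
      have [measurable]: "t \<in> space (M k)" by (rule elim)
      have "R k (slice k (avg J f) x) t = (\<integral>y. RI k (?G x) (y(k := t)) \<partial>PiM (I - {k}) M)"
        using elim(2,3) by (simp add: has_bochner_integral_integral_eq)
      also have "\<dots> = (\<integral>z. RI k (?G x) (z(k := t)) \<partial>P)"
        by (rule integral_others[OF kI elim(4)]) measurable
      also have "\<dots> = (\<integral>z. RI k f (mix ?K x (z(k := t))) \<partial>P)"
        using elim(1) by (intro integral_cong_AE) measurable
      also have "\<dots> = avg J (RI k f) (x(k := t))"
        by (simp add: avg_def mix_upd_inside[OF k])
      finally show ?case .
    qed
    then show ?case using sA by blast
  qed
qed

end

lemma operator_diff:
  assumes sub: "L2_subspace N B" and lin: "L2_linear_operator N B T" and u: "u \<in> B" and v: "v \<in> B"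
  shows "(\<lambda>t. u t - v t) \<in> B" and "AE t in N. T (\<lambda>t. u t - v t) t = T u t - T v t"
proof -
  have B: "\<forall>f\<in>B. \<forall>g\<in>B. (\<lambda>t. f t + g t) \<in> B" "\<forall>c. \<forall>f\<in>B. (\<lambda>t. c * f t) \<in> B"
    using sub unfolding L2_subspace_def by simp_all
  have T: "\<forall>f\<in>B. \<forall>g\<in>B. AE t in N. T (\<lambda>t. f t + g t) t = T f t + T g t"
    "\<forall>c. \<forall>f\<in>B. AE t in N. T (\<lambda>t. c * f t) t = c * T f t"
    using lin unfolding L2_linear_operator_def by simp_all
  have nv: "(\<lambda>t. - 1 * v t) \<in> B" by (rule bspec[OF spec[OF B(2)] v])
  have "(\<lambda>t. u t + - 1 * v t) \<in> B" by (rule bspec[OF bspec[OF B(1) u] nv])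
  then show "(\<lambda>t. u t - v t) \<in> B" by simp
  have "AE t in N. T (\<lambda>t. u t + - 1 * v t) t = T u t + T (\<lambda>t. - 1 * v t) t"
    by (rule bspec[OF bspec[OF T(1) u] nv])
  moreover have "AE t in N. T (\<lambda>t. - 1 * v t) t = - 1 * T v t"
    by (rule bspec[OF spec[OF T(2)] v])
  ultimately show "AE t in N. T (\<lambda>t. u t - v t) t = T u t - T v t"
    by eventually_elim simp
qed

context product_prob_space
begin

text \<open>
  The statement for families in which every \<open>M i\<close>, also for \<open>i\<close> outside \<open>I\<close>, is a probability space.
  It remains to check that slices of increments are in the domain of the operators and to identify
  their images.
\<close>

lemma variance_log_Sobolev:
  assumes I: "countable I"
    and sub: "\<And>i. i \<in> I \<Longrightarrow> L2_subspace (M i) (A i)"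
    and const: "\<And>i c. i \<in> I \<Longrightarrow> (\<lambda>t. c) \<in> A i"
    and lin: "\<And>i. i \<in> I \<Longrightarrow> L2_linear_operator (M i) (A i) (R i)"
    and R0: "\<And>i c. i \<in> I \<Longrightarrow> AE t in M i. R i (\<lambda>t. c) t = 0"
    and LS: "\<And>i f. i \<in> I \<Longrightarrow> f \<in> A i \<Longrightarrow> Ent (M i) (\<lambda>t. (f t)\<^sup>2) \<le> ereal (\<integral>t. (R i f t)\<^sup>2 \<partial>M i)"
    and ext: "\<And>i. i \<in> I \<Longrightarrow> coordinate_extension I M A i (R i) (RI i)"
    and marg: "\<And>i f. i \<in> I \<Longrightarrow> f \<in> product_class I M A \<Longrightarrow> integrate_others I M i f \<in> A i"
    and comm: "\<And>i f. i \<in> I \<Longrightarrow> f \<in> product_class I M A \<Longrightarrow> AE t in M i.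
         has_bochner_integral (PiM (I - {i}) M) (\<lambda>y. RI i f (y(i := t))) (R i (integrate_others I M i f) t)"
    and f: "f \<in> product_class I M A"
  shows "(let V = P.variance f;
         S = (\<Sum>\<^sub>\<infinity>i\<in>I. ennreal ((norm1 P (Delta M i f))\<^sup>2))
     in (if V = 0 then 0 else ereal V * ln_extended (ennreal V / S))
        \<le> enn2ereal (\<Sum>\<^sub>\<infinity>i\<in>I. \<integral>\<^sup>+x. ennreal ((RI i f x)\<^sup>2) \<partial>P))"
proof -
  define V where "V = P.variance f"
  define S where "S = (\<Sum>\<^sub>\<infinity>i\<in>I. ennreal ((norm1 P (Delta M i f))\<^sup>2))"
  define B where "B = (\<Sum>\<^sub>\<infinity>i\<in>I. \<integral>\<^sup>+x. ennreal ((RI i f x)\<^sup>2) \<partial>P)"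
  have V0: "0 \<le> V" unfolding V_def by (rule P.variance_positive)
  have fL: "f \<in> L2 P" using f by (simp add: product_class_iff)
  have "(if V = 0 then 0 else ereal V * ln_extended (ennreal V / S)) \<le> enn2ereal B"
  \<comment> \<open>an infinite \<open>B\<close> makes the bound trivial, an infinite \<open>S\<close> makes the logarithm \<open>-\<infinity>\<close>\<close>
  proof (cases "V = 0 \<or> B = top \<or> S = top")
    case True
    then show ?thesis using V0 by (auto simp: ln_extended_def)
  next
    case False
    then have Vpos: "0 < V" and Bfin: "B < top" and Sfin: "S < top"
      using V0 by (auto simp: top.not_eq_extremum)
    have gm: "RI k f \<in> borel_measurable P" if "k \<in> I" for k
      by (rule coordinate_extensionD(1)[OF ext[OF that] f that])
    have gL: "RI k f \<in> L2 P" if k: "k \<in> I" for k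
    proof -
      have "(\<integral>\<^sup>+x. ennreal ((RI k f x)\<^sup>2) \<partial>P) \<le> B"
        unfolding B_def using sum_le_infsum_ennreal[of "{k}" I] k by simp
      then have "(\<integral>\<^sup>+x. ennreal ((RI k f x)\<^sup>2) \<partial>P) < \<infinity>" using Bfin by simp
      then have "integrable P (\<lambda>x. (RI k f x)\<^sup>2)"
        using gm[OF k] by (intro integrableI_nonneg) auto
      then show ?thesis using gm[OF k] by (simp add: L2_def)
    qed
    have Sle: "(\<Sum>j\<in>J. (norm1 P (Delta M j f))\<^sup>2) \<le> enn2real S" if J: "finite J" "J \<subseteq> I" for J
    proof -
      have "ennreal (\<Sum>j\<in>J. (norm1 P (Delta M j f))\<^sup>2) = (\<Sum>j\<in>J. ennreal ((norm1 P (Delta M j f))\<^sup>2))"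
        by (rule sum_ennreal[symmetric]) simp
      also have "\<dots> \<le> S" unfolding S_def by (rule sum_le_infsum_ennreal[OF J])
      finally show ?thesis
        using enn2real_mono[OF _ Sfin, of "ennreal (\<Sum>j\<in>J. (norm1 P (Delta M j f))\<^sup>2)"]
        by (simp add: sum_nonneg)
    qed
    have Ble: "(\<Sum>k\<in>J. \<integral>x. (RI k f x)\<^sup>2 \<partial>P) \<le> enn2real B" if J: "finite J" "J \<subseteq> I" for J
    proof -
      have "ennreal (\<Sum>k\<in>J. \<integral>x. (RI k f x)\<^sup>2 \<partial>P) = (\<Sum>k\<in>J. ennreal (\<integral>x. (RI k f x)\<^sup>2 \<partial>P))"
        by (rule sum_ennreal[symmetric]) simp
      also have "\<dots> = (\<Sum>k\<in>J. \<integral>\<^sup>+x. ennreal ((RI k f x)\<^sup>2) \<partial>P)"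
      proof (rule sum.cong[OF refl])
        fix k assume "k \<in> J"
        then have "integrable P (\<lambda>x. (RI k f x)\<^sup>2)" using gL[of k] J by (auto simp: L2_def)
        then show "ennreal (\<integral>x. (RI k f x)\<^sup>2 \<partial>P) = (\<integral>\<^sup>+x. ennreal ((RI k f x)\<^sup>2) \<partial>P)"
          by (intro nn_integral_eq_integral[symmetric]) auto
      qed
      also have "\<dots> \<le> B" unfolding B_def by (rule sum_le_infsum_ennreal[OF J])
      finally show ?thesis
        using enn2real_mono[OF _ Bfin, of "ennreal (\<Sum>k\<in>J. \<integral>x. (RI k f x)\<^sup>2 \<partial>P)"]
        by (simp add: sum_nonneg)
    qed
    note op = operator_avg[OF I sub const lin ext marg comm f]
    have opA: "AE x in P. slice k (avg J f) x \<in> A k \<and>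
        (AE t in M k. R k (slice k (avg J f) x) t = avg J (RI k f) (x(k := t)))"
      if "J \<subseteq> I" "k \<in> J" for J k
      by (rule op; (rule that | assumption))
    have Rm: "R k u \<in> borel_measurable (M k)" if "k \<in> I" "u \<in> A k" for k u
      using lin[OF that(1)] that(2) by (auto simp: L2_linear_operator_def L2_def)
    have ent_new: "AE x in P. Ent (M j) (\<lambda>t. (increment j J f (x(j := t)))\<^sup>2)
        \<le> ereal (\<integral>t. (avg (insert j J) (RI j f) (x(j := t)))\<^sup>2 \<partial>M j)"
      if J: "finite J" "J \<subseteq> I" "j \<in> I" "j \<notin> J" for J j
    proof -
      note [measurable] = gm[OF J(3)] J(3)
      have JI: "insert j J \<subseteq> I" using J by auto
      show ?thesis
        using opA[OF JI insertI1] AE_space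
      proof eventually_elim
        case (elim x)
        have [measurable]: "x \<in> space P" by (rule elim)
        let ?c = "\<lambda>t. avg J f x" and ?u = "slice j (avg (insert j J) f) x"
        have inc: "increment j J f (x(j := t)) = ?u t - ?c t" for t
          by (simp add: increment_def slice_def avg_upd_outside[OF J(4)])
        note od = operator_diff[OF sub[OF J(3)] lin[OF J(3)] _ const[OF J(3)], of ?u "avg J f x"]
        have uA: "?u \<in> A j" using elim by blast
        have Ru: "AE t in M j. R j ?u t = avg (insert j J) (RI j f) (x(j := t))" using elim(1) by blast
        have d: "AE t in M j. R j (\<lambda>t. ?u t - ?c t) t = R j ?u t - R j (\<lambda>t. avg J f x) t"
          by (rule od(2)[OF uA])
        have Req: "AE t in M j. R j (\<lambda>t. ?u t - ?c t) t = avg (insert j J) (RI j f) (x(j := t))"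
          using d R0[OF J(3), of "avg J f x"] Ru by eventually_elim linarith
        have meas: "(\<lambda>t. avg (insert j J) (RI j f) (x(j := t))) \<in> borel_measurable (M j)"
          by measurable
        have "Ent (M j) (\<lambda>t. (?u t - ?c t)\<^sup>2) \<le>
            ereal (\<integral>t. (avg (insert j J) (RI j f) (x(j := t)))\<^sup>2 \<partial>M j)"
          using LS[OF J(3) od(1)[OF uA]]
          unfolding integral_square_cong_AE[OF Rm[OF J(3) od(1)[OF uA]] meas Req] .
        then show ?case by (simp only: inc)
      qed
    qed
    have ent_old: "AE x in P. Ent (M k) (\<lambda>t. (increment j J f (x(k := t)))\<^sup>2)
        \<le> ereal (\<integral>t. (increment j J (RI k f) (x(k := t)))\<^sup>2 \<partial>M k)"
      if J: "finite J" "J \<subseteq> I" "j \<in> I" "j \<notin> J" and k: "k \<in> J" for J j k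
    proof -
      have kI: "k \<in> I" using J k by auto
      note [measurable] = gm[OF kI] kI
      have JI: "insert j J \<subseteq> I" using J by auto
      show ?thesis
        using opA[OF JI insertI2[OF k]] opA[OF J(2) k] AE_space
      proof eventually_elim
        case (elim x)
        have [measurable]: "x \<in> space P" by (rule elim)
        let ?v = "slice k (avg J f) x" and ?u = "slice k (avg (insert j J) f) x"
        have inc: "increment j J f (x(k := t)) = ?u t - ?v t" for t
          by (simp add: increment_def slice_def)
        have uvA: "?u \<in> A k" "?v \<in> A k" using elim by blast+
        note od = operator_diff[OF sub[OF kI] lin[OF kI] uvA]
        have Req: "AE t in M k. R k (\<lambda>t. ?u t - ?v t) t = increment j J (RI k f) (x(k := t))"
          using od(2) elim(1)[THEN conjunct2] elim(2)[THEN conjunct2]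
          unfolding increment_def by eventually_elim linarith
        have meas: "(\<lambda>t. increment j J (RI k f) (x(k := t))) \<in> borel_measurable (M k)"
          unfolding increment_def by measurable
        have "Ent (M k) (\<lambda>t. (?u t - ?v t)\<^sup>2) \<le>
            ereal (\<integral>t. (increment j J (RI k f) (x(k := t)))\<^sup>2 \<partial>M k)"
          using LS[OF kI od(1)] unfolding integral_square_cong_AE[OF Rm[OF kI od(1)] meas Req] .
        then show ?case by (simp only: inc)
      qed
    qed
    note vb = variance_log_bound[where g="\<lambda>k. RI k f" and S="enn2real S" and B="enn2real B",
        OF fL gL ent_new ent_old Sle Ble, folded V_def]
    have zero: "V = 0" if "enn2real S = 0" by (rule vb(1); (rule that | assumption))
    have bound: "V * ln (V / enn2real S) \<le> enn2real B" by (rule vb(2); assumption)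
    have Spos: "0 < enn2real S" using zero Vpos enn2real_nonneg[of S] by linarith
    have SB: "ennreal (enn2real S) = S" "ennreal (enn2real B) = B" using Sfin Bfin by auto
    have Beq: "enn2ereal B = ereal (enn2real B)"
      using enn2ereal_ennreal[OF enn2real_nonneg[of B]] unfolding SB .
    have "ennreal V / S = ennreal (V / enn2real S)"
      using divide_ennreal[OF V0 Spos] unfolding SB .
    moreover have "V \<noteq> 0" "enn2real S \<noteq> 0" "0 < V / enn2real S" using Vpos Spos by auto
    ultimately have "ln_extended (ennreal V / S) = ereal (ln (V / enn2real S))"
      by (simp add: ln_extended_def)
    then show ?thesis using Vpos bound by (simp add: Beq)
  qed
  then show ?thesis unfolding V_def S_def B_def Let_def .
qed

end

theorem proposition2p1:
  fixes I :: "'i set"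
    and M :: "'i \<Rightarrow> 'a measure"
    and A :: "'i \<Rightarrow> ('a \<Rightarrow> real) set"
    and R :: "'i \<Rightarrow> ('a \<Rightarrow> real) \<Rightarrow> 'a \<Rightarrow> real"
    and RI :: "'i \<Rightarrow> (('i \<Rightarrow> 'a) \<Rightarrow> real) \<Rightarrow> ('i \<Rightarrow> 'a) \<Rightarrow> real"
  assumes countable_I: "countable I"
    and prob: "\<forall>i\<in>I. prob_space (M i)"
    and subspace_A: "\<forall>i\<in>I. L2_subspace (M i) (A i)"
    and const_A: "\<forall>i\<in>I. \<forall>c. (\<lambda>x. c) \<in> A i"
    and linear_R: "\<forall>i\<in>I. L2_linear_operator (M i) (A i) (R i)"
    and R_const: "\<forall>i\<in>I. \<forall>c. AE x in M i. R i (\<lambda>x. c) x = 0"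
    and log_Sobolev:
      "\<forall>i\<in>I. \<forall>f\<in>A i. Ent (M i) (\<lambda>x. (f x)\<^sup>2) \<le> ereal (\<integral>x. (R i f x)\<^sup>2 \<partial>M i)"
    and RI_extends: "\<forall>i\<in>I. coordinate_extension I M A i (R i) (RI i)"
    and marginal_in_A:
      "\<forall>i\<in>I. \<forall>f\<in>product_class I M A. integrate_others I M i f \<in> A i"
    and commute:
      "\<forall>i\<in>I. \<forall>f\<in>product_class I M A. AE t in M i.
         has_bochner_integral (PiM (I - {i}) M) (\<lambda>y. RI i f (y(i := t)))
           (R i (integrate_others I M i f) t)"
  shows "\<forall>f\<in>product_class I M A.
    (let V = prob_space.variance (PiM I M) f;
         S = (\<Sum>\<^sub>\<infinity>i\<in>I. ennreal ((norm1 (PiM I M) (Delta M i f))\<^sup>2))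
     in (if V = 0 then 0 else ereal V * ln_extended (ennreal V / S))
        \<le> enn2ereal (\<Sum>\<^sub>\<infinity>i\<in>I. \<integral>\<^sup>+x. ennreal ((RI i f x)\<^sup>2) \<partial>PiM I M))"
proof
  fix f assume f: "f \<in> product_class I M A"
  \<comment> \<open>outside \<open>I\<close> the measures \<open>M i\<close> are arbitrary; a point mass there makes every component a probability space\<close>
  define N where "N i = (if i \<in> I then M i else count_space {undefined})" for i
  interpret N: prob_space "N i" for i
    using prob by (cases "i \<in> I") (auto simp: N_def intro!: prob_spaceI)
  interpret N: product_prob_space N I by unfold_locales
  have NM: "N i = M i" if "i \<in> I" for i using that by (simp add: N_def)
  have P: "PiM I N = PiM I M" "\<And>i. PiM (I - {i}) N = PiM (I - {i}) M"
    by (intro PiM_cong refl; simp add: NM)+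
  have class_eq: "product_class I N A = product_class I M A"
    unfolding product_class_def P ..
  have io: "integrate_others I N i = integrate_others I M i" for i
    unfolding integrate_others_def[abs_def] P ..
  have Delta: "Delta N i = Delta M i" if "i \<in> I" for i
    unfolding Delta_def[abs_def] NM[OF that] ..
  have ext: "coordinate_extension I N A i (R i) (RI i)" if "i \<in> I" for i
    using bspec[OF RI_extends that] unfolding coordinate_extension_def class_eq P NM[OF that] .
  have S: "(\<Sum>\<^sub>\<infinity>i\<in>I. ennreal ((norm1 (PiM I M) (Delta N i f))\<^sup>2)) =
      (\<Sum>\<^sub>\<infinity>i\<in>I. ennreal ((norm1 (PiM I M) (Delta M i f))\<^sup>2))"
    by (intro infsum_cong) (simp add: Delta)
  show "let V = prob_space.variance (PiM I M) f;
         S = (\<Sum>\<^sub>\<infinity>i\<in>I. ennreal ((norm1 (PiM I M) (Delta M i f))\<^sup>2))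
     in (if V = 0 then 0 else ereal V * ln_extended (ennreal V / S))
        \<le> enn2ereal (\<Sum>\<^sub>\<infinity>i\<in>I. \<integral>\<^sup>+x. ennreal ((RI i f x)\<^sup>2) \<partial>PiM I M)"
  proof (rule N.variance_log_Sobolev[of A R RI f, unfolded P class_eq io S])
    fix i assume i: "i \<in> I"
    note NM = NM[OF i]
    show "L2_subspace (N i) (A i)" unfolding NM by (rule bspec[OF subspace_A i])
    show "L2_linear_operator (N i) (A i) (R i)" unfolding NM by (rule bspec[OF linear_R i])
    show "coordinate_extension I N A i (R i) (RI i)" by (rule ext[OF i])
    show "(\<lambda>t. c) \<in> A i" for c by (rule spec[OF bspec[OF const_A i]])
    show "AE t in N i. R i (\<lambda>t. c) t = 0" for c
      unfolding NM by (rule spec[OF bspec[OF R_const i]])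
    show "Ent (N i) (\<lambda>t. (g t)\<^sup>2) \<le> ereal (\<integral>t. (R i g t)\<^sup>2 \<partial>N i)" if "g \<in> A i" for g
      unfolding NM by (rule bspec[OF bspec[OF log_Sobolev i] that])
    fix g assume g: "g \<in> product_class I M A"
    show "integrate_others I M i g \<in> A i" by (rule bspec[OF bspec[OF marginal_in_A i] g])
    show "AE t in N i. has_bochner_integral (PiM (I - {i}) M) (\<lambda>y. RI i g (y(i := t)))
        (R i (integrate_others I M i g) t)"
      unfolding NM by (rule bspec[OF bspec[OF commute i] g])
  qed (rule countable_I, rule f)
qed

end
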